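(* Let $\mathcal I\subseteq \mathbb R[x,y,z]$ denote the set of all tensorial polynomials, and let $I_x=\langle y+z\rangle$, $I_y=\langle z+x\rangle$, $I_z=\langle x+y\rangle$ be the indicated principal ideals of $\mathbb R[x,y,z]$. Then $$\mathcal I = I_x I_y I_z$$ (the product of the three ideals).
   Context: For a (paracompact) smooth manifold $M$, let $\mathbb T M = TM\oplus T^*M$ be the generalized tangent bundle, with projection (anchor) $\pi:\mathbb TM\to TM$, the tautological inner product $\langle X+\alpha,Y+\beta\rangle=\tfrac12(\alpha(Y)+\beta(X))$, and the Courant-Dorfman bracket $[\![X+\alpha,Y+\beta]\!]=[X,Y]+\mathcal L_X\beta-i_Y d\alpha$ on $\Gamma(\mathbb TM)$, for $X,Y\in\Gamma(TM)$ and $1$-forms $\alpha,\beta$. Let $\Theta$ be the $C^\infty(M)$-module of $\mathbb R$-trilinear maps $\tau:\Gamma(\mathbb TM)\times\Gamma(\mathbb TM)\times\Gamma(\mathbb TM)\to C^\infty(M)$. The Courant element $\tau_C\in\Theta$ is $\tau_C(\mathbf x,\mathbf y,\mathbf z)=\langle[\![\mathbf x,\mathbf y]\!],\mathbf z\rangle$. A vector bundle endomorphism $J:\mathbb TM\to\mathbb TM$ (smooth, covering the identity of $M$) induces an action $\bullet_J$ of the polynomial ring $\mathbb R[x,y,z]$ on $\Theta$: for $P=\sum a_{i,j,k}x^iy^jz^k$, $(P\bullet_J\tau)(\mathbf x,\mathbf y,\mathbf z)=\sum a_{i,j,k}\,\tau(J^i(\mathbf x),J^j(\mathbf y),J^k(\mathbf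 z))$. $J$ is skew (skew-symmetric) if $\langle J(\mathbf x),\mathbf y\rangle=-\langle\mathbf x,J(\mathbf y)\rangle$ for all $\mathbf x,\mathbf y\in\Gamma(\mathbb TM)$. A pair $(P,J)$, with $P\in\mathbb R[x,y,z]$ and $J$ a skew endomorphism of $\mathbb TM$, is a tensorial pair if $P\bullet_J\tau_C$ is $C^\infty(M)$-trilinear. A polynomial $P\in\mathbb R[x,y,z]$ is tensorial if $(P,J)$ is a tensorial pair for every smooth manifold $M$ and every skew endomorphism $J:\mathbb TM\to\mathbb TM$. *)

theory Defs
  imports
    "HOL-Analysis.Analysis"
    "HOL-Computational_Algebra.Polynomial"
    "HOL-Algebra.Ideal_Product"
begin

section \<open>Smooth functions on open subsets of R^n\<close>

text \<open>
  The dimension of a manifold has to be quantified inside a formula, so R^n is the library space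
  \<^term>\<open>Euclidean_space n\<close>: sequences of reals vanishing from index \<open>n\<close> on, with the subspace topology
  of the product topology.
\<close>

definition partial :: "nat \<Rightarrow> ((nat \<Rightarrow> real) \<Rightarrow> real) \<Rightarrow> (nat \<Rightarrow> real) \<Rightarrow> real" where
  "partial i g = (\<lambda>u. deriv (\<lambda>t. g (u(i := t))) (u i))"

text \<open>
  \<open>g\<close> is of class C-infinity on the open set \<open>W\<close>: all iterated partial derivatives exist and are
  continuous on \<open>W\<close>.
\<close>

definition smooth_on :: "nat \<Rightarrow> (nat \<Rightarrow> real) set \<Rightarrow> ((nat \<Rightarrow> real) \<Rightarrow> real) \<Rightarrow> bool" where
  "smooth_on n W g \<longleftrightarrow>
    (\<forall>is. set is \<subseteq> {..<n} \<longrightarrow>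
      continuous_map (subtopology (Euclidean_space n) W) euclideanreal (foldr partial is g) \<and>
      (\<forall>u\<in>W. \<forall>i<n. (\<lambda>t. foldr partial is g (u(i := t))) differentiable (at (u i))))"


section \<open>Smooth manifolds\<close>

definition paracompact_space :: "'p topology \<Rightarrow> bool" where
  "paracompact_space X \<longleftrightarrow>
    (\<forall>\<U>. (\<forall>U\<in>\<U>. openin X U) \<and> \<Union>\<U> = topspace X \<longrightarrow>
      (\<exists>\<V>. (\<forall>V\<in>\<V>. openin X V \<and> (\<exists>U\<in>\<U>. V \<subseteq> U)) \<and> \<Union>\<V> = topspace X \<and> locally_finite_in X \<V>))"

text \<open>A chart is a pair of its domain and its coordinate map.\<close>

type_synonym 'p chart = "'p set \<times> ('p \<Rightarrow> nat \<Rightarrow> real)"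

record 'p manifold =
  mtop :: "'p topology"
  mdim :: nat
  atlas :: "'p chart set"

abbreviation points :: "'p manifold \<Rightarrow> 'p set" where
  "points M \<equiv> topspace (mtop M)"

abbreviation cdom :: "'p chart \<Rightarrow> 'p set" where
  "cdom c \<equiv> fst c"

abbreviation cmap :: "'p chart \<Rightarrow> 'p \<Rightarrow> nat \<Rightarrow> real" where
  "cmap c \<equiv> snd c"

definition cinv :: "'p chart \<Rightarrow> (nat \<Rightarrow> real) \<Rightarrow> 'p" where
  "cinv c = inv_into (cdom c) (cmap c)"

definition is_chart :: "'p topology \<Rightarrow> nat \<Rightarrow> 'p chart \<Rightarrow> bool" where
  "is_chart X n c \<longleftrightarrow>
    openin X (cdom c) \<and>
    openin (Euclidean_space n) (cmap c ` cdom c) \<and>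
    homeomorphic_map (subtopology X (cdom c))
      (subtopology (Euclidean_space n) (cmap c ` cdom c)) (cmap c)"

text \<open>The atlas is not required to be maximal; every notion below that refers to the charts of the
  atlas is unchanged when the atlas is enlarged by compatible charts.\<close>

definition smooth_manifold :: "'p manifold \<Rightarrow> bool" where
  "smooth_manifold M \<longleftrightarrow>
    Hausdorff_space (mtop M) \<and>
    paracompact_space (mtop M) \<and>
    (\<forall>c\<in>atlas M. is_chart (mtop M) (mdim M) c) \<and>
    (\<Union>c\<in>atlas M. cdom c) = points M \<and>
    (\<forall>c\<in>atlas M. \<forall>d\<in>atlas M. \<forall>i<mdim M.
      smooth_on (mdim M) (cmap c ` (cdom c \<inter> cdom d)) (\<lambda>u. cmap d (cinv c u) i))"

definition charts_at :: "'p manifold \<Rightarrow> 'p \<Rightarrow> 'p chart set" where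
  "charts_at M p = {c \<in> atlas M. p \<in> cdom c}"

definition smooth_in_chart :: "'p manifold \<Rightarrow> 'p chart \<Rightarrow> ('p \<Rightarrow> real) \<Rightarrow> bool" where
  "smooth_in_chart M c f \<longleftrightarrow> smooth_on (mdim M) (cmap c ` cdom c) (\<lambda>u. f (cinv c u))"

text \<open>
  Scalar functions and sections are total functions on the type of points; only their values on
  \<^term>\<open>points M\<close> are ever used.
\<close>

definition smooth_functions :: "'p manifold \<Rightarrow> ('p \<Rightarrow> real) set" where
  "smooth_functions M = {f. \<forall>c\<in>atlas M. smooth_in_chart M c f}"

text \<open>The derivative of \<open>f\<close> at \<open>p\<close> along the \<open>i\<close>-th coordinate of the chart \<open>c\<close>.\<close>

definition cpartial :: "'p chart \<Rightarrow> nat \<Rightarrow> ('p \<Rightarrow> real) \<Rightarrow> 'p \<Rightarrow> real" where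
  "cpartial c i f p = partial i (\<lambda>u. f (cinv c u)) (cmap c p)"


section \<open>The generalized tangent bundle\<close>

text \<open>
  A tangent (cotangent) vector at \<open>p\<close> is a family of coordinate vectors, one for each chart around
  \<open>p\<close>, that transforms by the Jacobian (transposed Jacobian) of the transition maps. Entries
  that carry no information are set to zero.
\<close>

type_synonym 'p tvec = "'p chart \<Rightarrow> nat \<Rightarrow> real"

definition supported_at :: "'p manifold \<Rightarrow> 'p \<Rightarrow> 'p tvec \<Rightarrow> bool" where
  "supported_at M p v \<longleftrightarrow> (\<forall>c i. \<not> (c \<in> charts_at M p \<and> i < mdim M) \<longrightarrow> v c i = 0)"

definition tangent_space :: "'p manifold \<Rightarrow> 'p \<Rightarrow> 'p tvec set" where
  "tangent_space M p = {v. supported_at M p v \<and>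
    (\<forall>c\<in>charts_at M p. \<forall>d\<in>charts_at M p. \<forall>i<mdim M.
      v d i = (\<Sum>j<mdim M. cpartial c j (\<lambda>q. cmap d q i) p * v c j))}"

definition cotangent_space :: "'p manifold \<Rightarrow> 'p \<Rightarrow> 'p tvec set" where
  "cotangent_space M p = {a. supported_at M p a \<and>
    (\<forall>c\<in>charts_at M p. \<forall>d\<in>charts_at M p. \<forall>i<mdim M.
      a c i = (\<Sum>j<mdim M. cpartial c i (\<lambda>q. cmap d q j) p * a d j))}"

text \<open>The evaluation of a covector on a vector; any chart around \<open>p\<close> computes it, see
  \<open>pairing_eq\<close> below.\<close>

definition pairing :: "'p manifold \<Rightarrow> 'p \<Rightarrow> 'p tvec \<Rightarrow> 'p tvec \<Rightarrow> real" where
  "pairing M p a v = (let c = (SOME c. c \<in> charts_at M p) in \<Sum>i<mdim M. a c i * v c i)"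

lemma pairing_eq:
  assumes a: "a \<in> cotangent_space M p" and v: "v \<in> tangent_space M p" and c: "c \<in> charts_at M p"
  shows "pairing M p a v = (\<Sum>i<mdim M. a c i * v c i)"
proof -
  define d where "d = (SOME c. c \<in> charts_at M p)"
  have d: "d \<in> charts_at M p"
    unfolding d_def using c by (rule someI)
  have a_eq: "a c i = (\<Sum>j<mdim M. cpartial c i (\<lambda>q. cmap d q j) p * a d j)" if "i < mdim M" for i
    using a c d that unfolding cotangent_space_def by blast
  have v_eq: "v d j = (\<Sum>i<mdim M. cpartial c i (\<lambda>q. cmap d q j) p * v c i)" if "j < mdim M" for j
    using v c d that unfolding tangent_space_def by blast
  have "(\<Sum>i<mdim M. a c i * v c i) =
      (\<Sum>i<mdim M. (\<Sum>j<mdim M. cpartial c i (\<lambda>q. cmap d q j) p * a d j) * v c i)"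
    by (intro sum.cong refl) (use a_eq in auto)
  also have "\<dots> = (\<Sum>i<mdim M. \<Sum>j<mdim M. cpartial c i (\<lambda>q. cmap d q j) p * a d j * v c i)"
    by (simp only: sum_distrib_right)
  also have "\<dots> = (\<Sum>j<mdim M. \<Sum>i<mdim M. cpartial c i (\<lambda>q. cmap d q j) p * a d j * v c i)"
    by (rule sum.swap)
  also have "\<dots> = (\<Sum>j<mdim M. a d j * v d j)"
  proof (intro sum.cong refl)
    fix j assume "j \<in> {..<mdim M}"
    then have "a d j * v d j = a d j * (\<Sum>i<mdim M. cpartial c i (\<lambda>q. cmap d q j) p * v c i)"
      using v_eq by auto
    then show "(\<Sum>i<mdim M. cpartial c i (\<lambda>q. cmap d q j) p * a d j * v c i) = a d j * v d j"
      by (simp only: sum_distrib_left mult_ac)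
  qed
  finally show ?thesis
    by (simp add: pairing_def d_def Let_def)
qed

text \<open>The vector \<open>X + \<alpha>\<close> is the pair of \<open>X\<close> and \<open>\<alpha>\<close>; the anchor is \<^const>\<open>fst\<close>.\<close>

type_synonym 'p gvec = "'p tvec \<times> 'p tvec"

definition gfibre :: "'p manifold \<Rightarrow> 'p \<Rightarrow> 'p gvec set" where
  "gfibre M p = tangent_space M p \<times> cotangent_space M p"

definition gadd :: "'p gvec \<Rightarrow> 'p gvec \<Rightarrow> 'p gvec" where
  "gadd v w = ((\<lambda>c i. fst v c i + fst w c i), (\<lambda>c i. snd v c i + snd w c i))"

definition gscale :: "real \<Rightarrow> 'p gvec \<Rightarrow> 'p gvec" where
  "gscale r v = ((\<lambda>c i. r * fst v c i), (\<lambda>c i. r * snd v c i))"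

definition ginner :: "'p manifold \<Rightarrow> 'p \<Rightarrow> 'p gvec \<Rightarrow> 'p gvec \<Rightarrow> real" where
  "ginner M p v w = (1 / 2) * (pairing M p (snd v) (fst w) + pairing M p (snd w) (fst v))"

text \<open>The \<open>2 * mdim M\<close> fibre coordinates in the local trivialization given by the chart \<open>c\<close>.\<close>

definition gcoord :: "'p manifold \<Rightarrow> 'p chart \<Rightarrow> 'p gvec \<Rightarrow> nat \<Rightarrow> real" where
  "gcoord M c v a = (if a < mdim M then fst v c a else snd v c (a - mdim M))"

type_synonym 'p gsec = "'p \<Rightarrow> 'p gvec"

definition gsections :: "'p manifold \<Rightarrow> 'p gsec set" where
  "gsections M = {s. (\<forall>p\<in>points M. s p \<in> gfibre M p) \<and>
    (\<forall>c\<in>atlas M. \<forall>a<2 * mdim M. smooth_in_chart M c (\<lambda>p. gcoord M c (s p) a))}"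


section \<open>The Courant-Dorfman bracket\<close>

text \<open>The Cartan operations are given by their classical expressions in the coordinates of a chart.\<close>

type_synonym 'p tfield = "'p \<Rightarrow> 'p tvec"

definition restrict_comps :: "'p manifold \<Rightarrow> 'p \<Rightarrow> 'p tvec \<Rightarrow> 'p tvec" where
  "restrict_comps M p v = (\<lambda>c i. if c \<in> charts_at M p \<and> i < mdim M then v c i else 0)"

definition lie_bracket :: "'p manifold \<Rightarrow> 'p tfield \<Rightarrow> 'p tfield \<Rightarrow> 'p tfield" where
  "lie_bracket M X Y p = restrict_comps M p (\<lambda>c i.
    \<Sum>j<mdim M. X p c j * cpartial c j (\<lambda>q. Y q c i) p - Y p c j * cpartial c j (\<lambda>q. X q c i) p)"

definition lie_derivative :: "'p manifold \<Rightarrow> 'p tfield \<Rightarrow> 'p tfield \<Rightarrow> 'p tfield" where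
  "lie_derivative M X \<beta> p = restrict_comps M p (\<lambda>c i.
    \<Sum>j<mdim M. X p c j * cpartial c j (\<lambda>q. \<beta> q c i) p + \<beta> p c j * cpartial c i (\<lambda>q. X q c j) p)"

text \<open>Components of \<open>d\<alpha>\<close>, with the convention
  \<open>d\<alpha>(U,V) = U(\<alpha>(V)) - V(\<alpha>(U)) - \<alpha>([U,V])\<close>.\<close>

definition ext_derivative :: "'p tfield \<Rightarrow> 'p \<Rightarrow> 'p chart \<Rightarrow> nat \<Rightarrow> nat \<Rightarrow> real" where
  "ext_derivative \<alpha> p c i j = cpartial c i (\<lambda>q. \<alpha> q c j) p - cpartial c j (\<lambda>q. \<alpha> q c i) p"

definition interior_d :: "'p manifold \<Rightarrow> 'p tfield \<Rightarrow> 'p tfield \<Rightarrow> 'p tfield" where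
  "interior_d M Y \<alpha> p = restrict_comps M p (\<lambda>c i.
    \<Sum>j<mdim M. Y p c j * ext_derivative \<alpha> p c j i)"

definition courant_bracket :: "'p manifold \<Rightarrow> 'p gsec \<Rightarrow> 'p gsec \<Rightarrow> 'p gsec" where
  "courant_bracket M s t = (let X = (\<lambda>p. fst (s p)); \<alpha> = (\<lambda>p. snd (s p));
      Y = (\<lambda>p. fst (t p)); \<beta> = (\<lambda>p. snd (t p)) in
    (\<lambda>p. (lie_bracket M X Y p,
      (\<lambda>c i. lie_derivative M X \<beta> p c i - interior_d M Y \<alpha> p c i))))"


section \<open>Tensorial polynomials\<close>

type_synonym 'p trilinear = "'p gsec \<Rightarrow> 'p gsec \<Rightarrow> 'p gsec \<Rightarrow> 'p \<Rightarrow> real"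

definition courant_element :: "'p manifold \<Rightarrow> 'p trilinear" where
  "courant_element M x y z = (\<lambda>p. ginner M p (courant_bracket M x y p) (z p))"

text \<open>
  Smooth vector bundle endomorphisms covering the identity: fibrewise linear maps that are given,
  in the local trivialization of every chart, by a matrix of smooth functions.
\<close>

definition bundle_endomorphism :: "'p manifold \<Rightarrow> ('p \<Rightarrow> 'p gvec \<Rightarrow> 'p gvec) \<Rightarrow> bool" where
  "bundle_endomorphism M J \<longleftrightarrow>
    (\<forall>p\<in>points M.
      (\<forall>v\<in>gfibre M p. J p v \<in> gfibre M p) \<and>
      (\<forall>v\<in>gfibre M p. \<forall>w\<in>gfibre M p. J p (gadd v w) = gadd (J p v) (J p w)) \<and>
      (\<forall>r. \<forall>v\<in>gfibre M p. J p (gscale r v) = gscale r (J p v))) \<and>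
    (\<forall>c\<in>atlas M. \<exists>A :: nat \<Rightarrow> nat \<Rightarrow> 'p \<Rightarrow> real.
      (\<forall>a<2 * mdim M. \<forall>b<2 * mdim M. smooth_in_chart M c (A a b)) \<and>
      (\<forall>p\<in>cdom c. \<forall>v\<in>gfibre M p. \<forall>a<2 * mdim M.
        gcoord M c (J p v) a = (\<Sum>b<2 * mdim M. A a b p * gcoord M c v b)))"

definition act :: "('p \<Rightarrow> 'p gvec \<Rightarrow> 'p gvec) \<Rightarrow> 'p gsec \<Rightarrow> 'p gsec" where
  "act J s = (\<lambda>p. J p (s p))"

definition skew :: "'p manifold \<Rightarrow> ('p \<Rightarrow> 'p gvec \<Rightarrow> 'p gvec) \<Rightarrow> bool" where
  "skew M J \<longleftrightarrow> (\<forall>x\<in>gsections M. \<forall>y\<in>gsections M. \<forall>p\<in>points M.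
    ginner M p (act J x p) (y p) = - ginner M p (x p) (act J y p))"

text \<open>
  \<open>\<real>[x,y,z]\<close> is represented as \<open>\<real>[x][y][z]\<close>: the coefficient of \<open>x^i y^j z^k\<close> in \<open>P\<close> is
  \<open>coeff (coeff (coeff P k) j) i\<close>.
\<close>

type_synonym poly3 = "real poly poly poly"

definition var_x :: poly3 where "var_x = [:[:[:0, 1:]:]:]"
definition var_y :: poly3 where "var_y = [:[:0, 1:]:]"
definition var_z :: poly3 where "var_z = [:0, 1:]"

definition poly_action ::
  "poly3 \<Rightarrow> ('p \<Rightarrow> 'p gvec \<Rightarrow> 'p gvec) \<Rightarrow> 'p trilinear \<Rightarrow> 'p trilinear" where
  "poly_action P J \<tau> x y z = (\<lambda>p.
    \<Sum>k\<le>degree P. \<Sum>j\<le>degree (coeff P k). \<Sum>i\<le>degree (coeff (coeff P k) j).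
      coeff (coeff (coeff P k) j) i *
      \<tau> ((act J ^^ i) x) ((act J ^^ j) y) ((act J ^^ k) z) p)"

definition sec_add :: "'p gsec \<Rightarrow> 'p gsec \<Rightarrow> 'p gsec" where
  "sec_add s t = (\<lambda>p. gadd (s p) (t p))"

definition sec_scale :: "('p \<Rightarrow> real) \<Rightarrow> 'p gsec \<Rightarrow> 'p gsec" where
  "sec_scale f s = (\<lambda>p. gscale (f p) (s p))"

text \<open>
  Linearity over the smooth functions in each argument. Smoothness of the values is not repeated
  here: \<open>courant_element\<close>, and hence \<open>poly_action P J (courant_element M)\<close>, takes sections to smooth
  functions.
\<close>

definition smooth_trilinear :: "'p manifold \<Rightarrow> 'p trilinear \<Rightarrow> bool" where
  "smooth_trilinear M \<tau> \<longleftrightarrow>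
    (\<forall>x\<in>gsections M. \<forall>y\<in>gsections M. \<forall>z\<in>gsections M. \<forall>w\<in>gsections M.
      \<forall>f\<in>smooth_functions M. \<forall>p\<in>points M.
      \<tau> (sec_add x w) y z p = \<tau> x y z p + \<tau> w y z p \<and>
      \<tau> x (sec_add y w) z p = \<tau> x y z p + \<tau> x w z p \<and>
      \<tau> x y (sec_add z w) p = \<tau> x y z p + \<tau> x y w p \<and>
      \<tau> (sec_scale f x) y z p = f p * \<tau> x y z p \<and>
      \<tau> x (sec_scale f y) z p = f p * \<tau> x y z p \<and>
      \<tau> x y (sec_scale f z) p = f p * \<tau> x y z p)"

definition tensorial_pair ::
  "'p manifold \<Rightarrow> poly3 \<Rightarrow> ('p \<Rightarrow> 'p gvec \<Rightarrow> 'p gvec) \<Rightarrow> bool" where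
  "tensorial_pair M P J \<longleftrightarrow> bundle_endomorphism M J \<and> skew M J \<and>
    smooth_trilinear M (poly_action P J (courant_element M))"

text \<open>
  Quantification over all manifolds is quantification over all manifolds whose points are taken
  from the type \<open>'p\<close>, which remains a parameter. A type that does not contain a copy of the reals
  carries only empty or zero-dimensional manifolds, over which every polynomial is tensorial; hence results
  about \<open>tensorial\<close> have to assume that \<open>'p\<close> is at least as large as the reals.
\<close>

definition tensorial :: "'p itself \<Rightarrow> poly3 \<Rightarrow> bool" where
  "tensorial (_ :: 'p itself) P \<longleftrightarrow>
    (\<forall>(M :: 'p manifold) J. smooth_manifold M \<and> bundle_endomorphism M J \<and> skew M J \<longrightarrow>
      tensorial_pair M P J)"

definition poly3_ring :: "poly3 ring" where
  "poly3_ring = \<lparr>carrier = UNIV, mult = (*), one = 1, zero = 0, add = (+)\<rparr>"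

definition ideal_x :: "poly3 set" where "ideal_x = PIdl\<^bsub>poly3_ring\<^esub> (var_y + var_z)"
definition ideal_y :: "poly3 set" where "ideal_y = PIdl\<^bsub>poly3_ring\<^esub> (var_z + var_x)"
definition ideal_z :: "poly3 set" where "ideal_z = PIdl\<^bsub>poly3_ring\<^esub> (var_x + var_y)"

end

theory Submission
  imports Defs
begin

text \<open>
  The Courant element is additive in each argument, and its failure to be linear over functions is
  given by the two Leibniz rules
  \<open>\<tau>(x, f y, z) = f \<tau>(x, y, z) + (\<pi>(x) f) \<langle>y, z\<rangle>\<close> and
  \<open>\<tau>(f x, y, z) = f \<tau>(x, y, z) - (\<pi>(y) f) \<langle>x, z\<rangle> + (\<pi>(z) f) \<langle>x, y\<rangle>\<close>
  (\<open>courant_element_scale_2\<close>, \<open>courant_element_scale_1\<close>); in the third argument it is linear. Acting by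
  \<open>P\<close> therefore produces three defects. Each is the sum over the monomials of \<open>P\<close> of a coefficient
  times a product of the form \<open>(\<pi>(J\<^sup>i x) f) \<langle>J\<^sup>j y, J\<^sup>k z\<rangle>\<close>, with the roles of
  \<open>x\<close>, \<open>y\<close>, \<open>z\<close> permuted.

  Skewness moves \<open>J\<close> across the inner product at the cost of a sign, so multiplying \<open>P\<close> by
  \<open>y + z\<close> annihilates the defect that contains \<open>\<langle>y, z\<rangle>\<close>, and likewise for the other two linear forms.
  Hence every multiple of \<open>(y + z)(z + x)(x + y)\<close> is tensorial (\<open>tensorial_if_dvd\<close>).

  Conversely, take the plane with \<open>J = A \<oplus> (- A\<^sup>T)\<close> for the constant matrix \<open>A = diag(a, b)\<close>.
  The coordinate vector fields and the coordinate covector fields are eigensections with eigenvalues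
  \<open>a\<close>, \<open>b\<close> and \<open>- a\<close>, \<open>- b\<close>. On eigensections each defect is a value of \<open>P\<close> times a constant, and
  three choices of eigensections isolate the three defects. So a tensorial polynomial vanishes at
  \<open>(a, b, - b)\<close>, at \<open>(b, a, - b)\<close> and at \<open>(b, - b, a)\<close> for all reals \<open>a\<close> and \<open>b\<close>
  (\<open>tensorial_eval3_eq_0\<close>), that is, on three planes. A polynomial that vanishes on them is divisible
  by the three linear forms (\<open>dvd_product_of_linear_forms\<close>). The injection of the reals into the type
  of points serves to place a copy of the plane in that type.

  Beyond this algebra, two analytic facts are needed: the powers of \<open>J\<close> preserve smooth sections, which rests
  on the stability of smooth functions under sums and products, and Euclidean space is a paracompact manifold.
\<close>

section \<open>Substituting an array for the monomials of a polynomial\<close>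

text \<open>
  The coefficients are passed through a function instead of being multiplied by a scalar, so that
  this single sum can be nested three times for \<open>\<real>[x][y][z]\<close>.
\<close>

definition coeff_sum :: "(nat \<Rightarrow> 'a \<Rightarrow> real) \<Rightarrow> 'a::zero poly \<Rightarrow> real" where
  "coeff_sum \<phi> p = (\<Sum>k\<le>degree p. \<phi> k (coeff p k))"

definition monomial_sum :: "poly3 \<Rightarrow> (nat \<Rightarrow> nat \<Rightarrow> nat \<Rightarrow> real) \<Rightarrow> real" where
  "monomial_sum P t =
    coeff_sum (\<lambda>k. coeff_sum (\<lambda>j. coeff_sum (\<lambda>i c. c * t i j k))) P"

lemma monomial_sum_eq:
  "monomial_sum P t =
    (\<Sum>k\<le>degree P. \<Sum>j\<le>degree (coeff P k). \<Sum>i\<le>degree (coeff (coeff P k) j).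
      coeff (coeff (coeff P k) j) i * t i j k)"
  by (simp add: monomial_sum_def coeff_sum_def)

text \<open>
  The action of a polynomial is thereby linear in the polynomial, and multiplication by a variable
  becomes a shift of an index; sections enter only through the array.
\<close>

lemma poly_action_eq_monomial_sum:
  "poly_action P J \<tau> x y z p =
    monomial_sum P (\<lambda>i j k. \<tau> ((act J ^^ i) x) ((act J ^^ j) y) ((act J ^^ k) z) p)"
  by (simp add: poly_action_def monomial_sum_eq)

lemma monomial_sum_plus: "monomial_sum P (\<lambda>i j k. s i j k + t i j k) = monomial_sum P s + monomial_sum P t"
  by (simp add: monomial_sum_eq distrib_left sum.distrib)

lemma monomial_sum_scale: "monomial_sum P (\<lambda>i j k. r * t i j k) = r * monomial_sum P t"
  by (simp add: monomial_sum_eq sum_distrib_left mult_ac)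

lemma coeff_sum_atMost:
  assumes "\<And>k. \<phi> k 0 = 0" "degree p \<le> N"
  shows "coeff_sum \<phi> p = (\<Sum>k\<le>N. \<phi> k (coeff p k))"
  unfolding coeff_sum_def
  by (rule sum.mono_neutral_left) (use assms in \<open>auto simp: coeff_eq_0\<close>)

lemma coeff_sum_zero [simp]: "\<phi> 0 0 = 0 \<Longrightarrow> coeff_sum \<phi> 0 = 0"
  by (simp add: coeff_sum_def)

lemma coeff_sum_add:
  fixes p q :: "'a::comm_monoid_add poly"
  assumes "\<And>k. \<phi> k 0 = 0" "\<And>k a b. \<phi> k (a + b) = \<phi> k a + \<phi> k b"
  shows "coeff_sum \<phi> (p + q) = coeff_sum \<phi> p + coeff_sum \<phi> q"
proof -
  let ?N = "max (degree p) (degree q)"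
  have "coeff_sum \<phi> (p + q) = (\<Sum>k\<le>?N. \<phi> k (coeff (p + q) k))"
    by (rule coeff_sum_atMost) (auto simp: assms degree_add_le_max)
  also have "\<dots> = (\<Sum>k\<le>?N. \<phi> k (coeff p k)) + (\<Sum>k\<le>?N. \<phi> k (coeff q k))"
    by (simp add: assms sum.distrib)
  also have "\<dots> = coeff_sum \<phi> p + coeff_sum \<phi> q"
    by (simp add: coeff_sum_atMost[of \<phi> _ ?N] assms)
  finally show ?thesis .
qed

lemma coeff_sum_pCons_0:
  fixes p :: "'a::zero poly"
  assumes "\<And>k. \<phi> k 0 = 0"
  shows "coeff_sum \<phi> (pCons 0 p) = coeff_sum (\<lambda>k. \<phi> (Suc k)) p"
proof -
  have "coeff_sum \<phi> (pCons 0 p) = (\<Sum>k\<le>Suc (degree p). \<phi> k (coeff (pCons 0 p) k))"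
    by (rule coeff_sum_atMost) (auto simp: assms degree_pCons_le)
  also have "\<dots> = coeff_sum (\<lambda>k. \<phi> (Suc k)) p"
    by (subst sum.atMost_Suc_shift) (simp add: assms coeff_sum_def)
  finally show ?thesis .
qed

lemma coeff_sum_smult:
  fixes p :: "'a::comm_semiring_0 poly"
  assumes "\<And>k. \<phi> k 0 = 0"
  shows "coeff_sum \<phi> (smult c p) = coeff_sum (\<lambda>k a. \<phi> k (c * a)) p"
proof -
  have "coeff_sum \<phi> (smult c p) = (\<Sum>k\<le>degree p. \<phi> k (coeff (smult c p) k))"
    by (rule coeff_sum_atMost) (auto simp: assms degree_smult_le)
  then show ?thesis
    by (simp add: coeff_sum_def)
qed

lemma monomial_sum_add: "monomial_sum (P + Q) t = monomial_sum P t + monomial_sum Q t"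
  unfolding monomial_sum_def
  by (intro coeff_sum_add) (simp_all add: coeff_sum_add distrib_right)

lemma monomial_sum_var_x: "monomial_sum (var_x * P) t = monomial_sum P (\<lambda>i j k. t (Suc i) j k)"
  unfolding monomial_sum_def var_x_def by (simp add: coeff_sum_smult coeff_sum_pCons_0)

lemma monomial_sum_var_y: "monomial_sum (var_y * P) t = monomial_sum P (\<lambda>i j k. t i (Suc j) k)"
  unfolding monomial_sum_def var_y_def by (simp add: coeff_sum_smult coeff_sum_pCons_0)

lemma monomial_sum_var_z: "monomial_sum (var_z * P) t = monomial_sum P (\<lambda>i j k. t i j (Suc k))"
  unfolding monomial_sum_def var_z_def by (simp add: coeff_sum_pCons_0)

text \<open>
  Multiplication by \<open>y + z\<close> replaces the array \<open>t\<close> by the sum of its shifts in the second and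
  the third index. Skewness will make that sum vanish.
\<close>

lemma monomial_sum_eq_0:
  shows "(\<And>i j k. t i (Suc j) k + t i j (Suc k) = 0) \<Longrightarrow> monomial_sum ((var_y + var_z) * P) t = 0"
    and "(\<And>i j k. t i j (Suc k) + t (Suc i) j k = 0) \<Longrightarrow> monomial_sum ((var_z + var_x) * P) t = 0"
    and "(\<And>i j k. t (Suc i) j k + t i (Suc j) k = 0) \<Longrightarrow> monomial_sum ((var_x + var_y) * P) t = 0"
  by (simp_all add: distrib_right monomial_sum_add monomial_sum_var_x monomial_sum_var_y
      monomial_sum_var_z flip: monomial_sum_plus) (simp_all add: monomial_sum_eq)

text \<open>
  Evaluation of a polynomial, transported through an additive map \<open>\<psi>\<close>. This lets the three nested sums
  in \<open>monomial_sum\<close> be evaluated from the inside outwards.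
\<close>

lemma coeff_sum_eq_poly:
  fixes p :: "'a::comm_semiring_1 poly"
  assumes \<phi>: "\<And>k a. \<phi> k a = \<psi> (a * e ^ k)"
    and \<psi>: "\<psi> 0 = 0" "\<And>a b. \<psi> (a + b) = \<psi> a + \<psi> b"
  shows "coeff_sum \<phi> p = \<psi> (poly p e)"
proof -
  have "\<psi> (sum f A) = (\<Sum>k\<in>A. \<psi> (f k))" if "finite A" for f and A :: "nat set"
    using that by induction (simp_all add: \<psi>)
  then show ?thesis by (simp add: coeff_sum_def poly_altdef \<phi>)
qed

abbreviation eval3 :: "poly3 \<Rightarrow> real \<Rightarrow> real \<Rightarrow> real \<Rightarrow> real" where
  "eval3 P a b c \<equiv> poly (poly (poly P [:[:c:]:]) [:b:]) a"

lemma monomial_sum_powers: "monomial_sum P (\<lambda>i j k. a ^ i * b ^ j * c ^ k) = eval3 P a b c"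
proof -
  have inner: "coeff_sum (\<lambda>i x. x * (a ^ i * b ^ j * c ^ k)) r = poly r a * (b ^ j * c ^ k)" for r j k
    by (rule coeff_sum_eq_poly) (auto simp: algebra_simps)
  have b: "poly ([:b:] ^ j) a = b ^ j" for j
    by (simp add: poly_power)
  have c: "poly (poly ([:[:c:]:] ^ k) [:b:]) a = c ^ k" for k
    by (simp add: poly_power)
  have middle: "coeff_sum (\<lambda>j. coeff_sum (\<lambda>i x. x * (a ^ i * b ^ j * c ^ k))) q
      = poly (poly q [:b:]) a * c ^ k" for q k
    unfolding inner
    by (rule coeff_sum_eq_poly[where \<psi>="\<lambda>r. poly r a * c ^ k"]) (auto simp: algebra_simps b)
  show ?thesis
    unfolding monomial_sum_def middle
    by (rule coeff_sum_eq_poly[where \<psi>="\<lambda>q. poly (poly q [:b:]) a"]) (auto simp: c)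
qed

section \<open>Divisibility by the three linear forms\<close>

lemma poly2_eq_0:
  fixes p :: "real poly poly"
  assumes "\<And>a b. poly (poly p [:b:]) a = 0"
  shows "p = 0"
proof -
  have *: "poly p [:b:] = 0" for b
    using assms poly_all_0_iff_0 by blast
  have "infinite (range (\<lambda>b::real. [:b:]))"
    using finite_imageD[of "\<lambda>b::real. [:b:]" UNIV] infinite_UNIV_char_0 by (auto simp: inj_def)
  moreover have "range (\<lambda>b::real. [:b:]) \<subseteq> {x. poly p x = 0}"
    using * by auto
  ultimately show ?thesis
    using poly_roots_finite finite_subset by blast
qed

text \<open>
  Substituting a polynomial in \<open>x\<close>, \<open>y\<close> for \<open>z\<close> commutes with evaluation at a point, so that
  vanishing after the substitution can be tested pointwise.
\<close>

lemma poly_poly_subst: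
  "poly (poly (poly P q) [:b:]) a = poly (poly (poly P [:[:poly (poly q [:b:]) a:]:]) [:b:]) a"
  for P :: poly3
  by (induction P) auto

text \<open>
  In \<open>\<real>[x,y][z]\<close> the forms \<open>y + z\<close> and \<open>z + x\<close> are monic in \<open>z\<close>, so divisibility by them is
  vanishing at \<open>z = - y\<close> and \<open>z = - x\<close>. The form \<open>x + y\<close> is a constant there and is split off first,
  coefficient by coefficient: it does not vanish at \<open>z = - y\<close> or \<open>z = - x\<close>, so the remaining quotient
  inherits the other two zeros, and \<open>y + z\<close> does not vanish at \<open>z = - x\<close> either.
\<close>

lemma dvd_product_of_linear_forms:
  assumes xy: "\<And>a c. eval3 P a (- a) c = 0"
    and yz: "\<And>a b. eval3 P a b (- b) = 0"
    and zx: "\<And>a b. eval3 P a b (- a) = 0"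
  shows "(var_y + var_z) * (var_z + var_x) * (var_x + var_y) dvd P"
proof -
  have "[:[:0, 1:], 1:] dvd coeff P k" for k
  proof -
    have "poly (coeff P k) (- [:0, 1:]) = 0"
    proof -
      have "poly (poly (coeff P k) [:- a:]) a = 0" for a
      proof -
        \<comment> \<open>For a fixed value of x, the coefficients of P at y = - x form a polynomial in z that
          vanishes everywhere.\<close>
        let ?p = "map_poly (\<lambda>q. poly (poly q [:- a:]) a) P"
        have ev: "poly ?p c = eval3 P a (- a) c" for c
          by (induction P) (auto simp: map_poly_pCons)
        then have "?p = 0"
          using xy poly_all_0_iff_0 by metis
        then show ?thesis
          by (metis (no_types, lifting) coeff_0 coeff_map_poly poly_0)
      qed
      moreover have "poly (poly q (- [:0, 1:])) a = poly (poly q [:- a:]) a" for q :: "real poly poly" and a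
        by (induction q) auto
      ultimately show ?thesis
        by (metis poly_all_0_iff_0)
    qed
    then show ?thesis
      by (simp add: poly_eq_0_iff_dvd)
  qed
  then have "[:[:[:0, 1:], 1:]:] dvd P"
    by (simp add: const_poly_dvd_iff)
  then obtain Q where Q: "P = (var_x + var_y) * Q"
    by (auto simp: dvd_def var_x_def var_y_def)
  have "poly P (- [:0, 1:]) = 0"
    by (rule poly2_eq_0) (subst poly_poly_subst, simp add: yz)
  moreover have "poly (var_x + var_y) (- [:0, 1:]) \<noteq> 0"
    by (simp add: var_x_def var_y_def)
  ultimately have "poly Q (- [:0, 1:]) = 0"
    unfolding Q poly_mult by (simp only: mult_eq_0_iff) simp
  then obtain R where R: "Q = (var_y + var_z) * R"
    by (auto simp: poly_eq_0_iff_dvd dvd_def var_z_def var_y_def)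
  have "poly P (- [:[:0, 1:]:]) = 0"
    by (rule poly2_eq_0) (subst poly_poly_subst, simp add: zx)
  moreover have "poly (var_x + var_y) (- [:[:0, 1:]:]) \<noteq> 0" "poly (var_y + var_z) (- [:[:0, 1:]:]) \<noteq> 0"
    by (simp_all add: var_x_def var_y_def var_z_def)
  ultimately have "poly R (- [:[:0, 1:]:]) = 0"
    unfolding Q R poly_mult by (simp only: mult_eq_0_iff) simp
  then obtain S where S: "R = (var_z + var_x) * S"
    by (auto simp: poly_eq_0_iff_dvd dvd_def var_z_def var_x_def)
  show ?thesis
    unfolding Q R S by (rule dvdI[of _ _ S]) (simp only: mult_ac)
qed

section \<open>Products of principal ideals\<close>

lemma cring_poly3_ring: "cring poly3_ring"
  by (rule cringI)
    (auto simp: poly3_ring_def algebra_simps intro!: abelian_groupI comm_monoidI exI[of _ "- x" for x]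
      intro: bexI[of _ "- x" for x])

lemma (in cring) cgenideal_prod:
  assumes "a \<in> carrier R" "b \<in> carrier R"
  shows "(PIdl a) \<cdot> (PIdl b) = PIdl (a \<otimes> b)"
proof
  show "(PIdl a) \<cdot> (PIdl b) \<subseteq> PIdl (a \<otimes> b)"
  proof
    fix s assume "s \<in> (PIdl a) \<cdot> (PIdl b)"
    then show "s \<in> PIdl (a \<otimes> b)"
    proof induction
      case (prod i j)
      then obtain u v where "u \<in> carrier R" "v \<in> carrier R" "i = u \<otimes> a" "j = v \<otimes> b"
        by (auto simp: cgenideal_def)
      then have "i \<otimes> j = (u \<otimes> v) \<otimes> (a \<otimes> b)" "u \<otimes> v \<in> carrier R"
        using assms by (simp_all add: m_ac)
      then show ?case by (auto simp: cgenideal_def)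
    next
      case (sum s1 s2)
      then show ?case
        using cgenideal_ideal[of "a \<otimes> b"] assms
        by (simp add: additive_subgroup.a_closed ideal.axioms(1))
    qed
  qed
  show "PIdl (a \<otimes> b) \<subseteq> (PIdl a) \<cdot> (PIdl b)"
  proof
    fix s assume "s \<in> PIdl (a \<otimes> b)"
    then obtain u where u: "u \<in> carrier R" "s = u \<otimes> (a \<otimes> b)"
      by (auto simp: cgenideal_def)
    then have "s = (u \<otimes> a) \<otimes> (\<one> \<otimes> b)"
      using assms by (simp add: m_ac)
    then show "s \<in> (PIdl a) \<cdot> (PIdl b)"
      using u by (auto simp: cgenideal_def intro!: ideal_prod.prod)
  qed
qed

lemma ideal_product_eq_multiples:
  "(ideal_x \<cdot>\<^bsub>poly3_ring\<^esub> ideal_y) \<cdot>\<^bsub>poly3_ring\<^esub> ideal_z =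
    {P. (var_y + var_z) * (var_z + var_x) * (var_x + var_y) dvd P}"
proof -
  interpret cring poly3_ring by (rule cring_poly3_ring)
  have carrier: "Q \<in> carrier poly3_ring" for Q
    by (simp add: poly3_ring_def)
  have "(ideal_x \<cdot>\<^bsub>poly3_ring\<^esub> ideal_y) \<cdot>\<^bsub>poly3_ring\<^esub> ideal_z =
      PIdl\<^bsub>poly3_ring\<^esub> (((var_y + var_z) \<otimes>\<^bsub>poly3_ring\<^esub> (var_z + var_x)) \<otimes>\<^bsub>poly3_ring\<^esub> (var_x + var_y))"
    unfolding ideal_x_def ideal_y_def ideal_z_def
    by (simp add: cgenideal_prod carrier)
  then show ?thesis
    by (simp add: poly3_ring_def cgenideal_def dvd_def mult_ac)
qed

section \<open>Smooth functions\<close>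

text \<open>
  Partial derivatives at a point of an open set depend only on the values in that set, because a
  coordinate line through the point stays in the set near the point.
\<close>

lemma eventually_coordinate_line:
  assumes "openin (Euclidean_space n) W" "u \<in> W" "i < n"
  shows "\<forall>\<^sub>F t in nhds (u i). u(i := t) \<in> W"
proof -
  have u: "\<forall>k\<ge>n. u k = 0"
    using assms openin_subset[of "Euclidean_space n" W] by (auto simp: topspace_Euclidean_space)
  have "continuous_map euclideanreal (Euclidean_space n) (\<lambda>t. u(i := t))"
    unfolding Euclidean_space_def continuous_map_in_subtopology
    using u assms(3) by (auto simp: continuous_map_componentwise_UNIV)
  then have "openin euclideanreal {t \<in> topspace euclideanreal. u(i := t) \<in> W}"
    using assms(1) by (rule openin_continuous_map_preimage)
  then have "open {t. u(i := t) \<in> W}"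
    by simp
  then show ?thesis
    using assms(2) by (intro eventually_nhds[THEN iffD2] exI[of _ "{t. u(i := t) \<in> W}"]) auto
qed

definition partially_differentiable :: "nat \<Rightarrow> ((nat \<Rightarrow> real) \<Rightarrow> real) \<Rightarrow> (nat \<Rightarrow> real) \<Rightarrow> bool" where
  "partially_differentiable i g u \<longleftrightarrow> (\<lambda>t. g (u(i := t))) differentiable (at (u i))"

lemma partially_differentiable_iff_DERIV:
  "partially_differentiable i g u \<longleftrightarrow> ((\<lambda>t. g (u(i := t))) has_real_derivative partial i g u) (at (u i))"
  unfolding partially_differentiable_def partial_def
  by (metis DERIV_deriv_iff_real_differentiable)

lemma partial_eqI:
  assumes "((\<lambda>t. g (u(i := t))) has_real_derivative D) (at (u i))"
  shows "partially_differentiable i g u" "partial i g u = D"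
  using assms by (auto simp: partially_differentiable_def partial_def real_differentiable_def DERIV_imp_deriv)

lemma partial_cong:
  assumes W: "openin (Euclidean_space n) W" "u \<in> W" "i < n" and eq: "\<And>v. v \<in> W \<Longrightarrow> g v = h v"
  shows "partial i g u = partial i h u"
    and "partially_differentiable i g u \<longleftrightarrow> partially_differentiable i h u"
proof -
  have ev: "\<forall>\<^sub>F t in nhds (u i). g (u(i := t)) = h (u(i := t))"
    using eventually_coordinate_line[OF W] by eventually_elim (rule eq)
  show p: "partial i g u = partial i h u"
    unfolding partial_def by (rule deriv_cong_ev) (use ev in auto)
  show "partially_differentiable i g u \<longleftrightarrow> partially_differentiable i h u"
    unfolding partially_differentiable_iff_DERIV p by (rule DERIV_cong_ev) (use ev in auto)
qed

lemma partial_add: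
  assumes "partially_differentiable i g u" "partially_differentiable i h u"
  shows "partially_differentiable i (\<lambda>v. g v + h v) u"
    and "partial i (\<lambda>v. g v + h v) u = partial i g u + partial i h u"
proof -
  have "((\<lambda>t. g (u(i := t)) + h (u(i := t))) has_real_derivative partial i g u + partial i h u) (at (u i))"
    using assms unfolding partially_differentiable_iff_DERIV by (rule DERIV_add)
  then show "partially_differentiable i (\<lambda>v. g v + h v) u"
    and "partial i (\<lambda>v. g v + h v) u = partial i g u + partial i h u"
    by (rule partial_eqI)+
qed

lemma partial_mult:
  assumes "partially_differentiable i g u" "partially_differentiable i h u"
  shows "partially_differentiable i (\<lambda>v. g v * h v) u"
    and "partial i (\<lambda>v. g v * h v) u = partial i g u * h u + g u * partial i h u"
proof -
  have "((\<lambda>t. g (u(i := t)) * h (u(i := t))) has_real_derivative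
      partial i g u * h u + g u * partial i h u) (at (u i))"
    using assms unfolding partially_differentiable_iff_DERIV
    by (auto intro!: derivative_eq_intros simp: algebra_simps)
  then show "partially_differentiable i (\<lambda>v. g v * h v) u"
    and "partial i (\<lambda>v. g v * h v) u = partial i g u * h u + g u * partial i h u"
    by (rule partial_eqI)+
qed

lemma partial_const: "partially_differentiable i (\<lambda>v. r) u" "partial i (\<lambda>v. r) = (\<lambda>v. 0)"
  using partial_eqI[of "\<lambda>v. r" _ i 0] by auto

lemma partial_coordinate:
  "partially_differentiable i (\<lambda>v. v k) u" "partial i (\<lambda>v. v k) = (\<lambda>v. if i = k then 1 else 0)"
proof -
  have "((\<lambda>t. (u(i := t)) k) has_real_derivative (if i = k then 1 else 0)) (at (u i))" for u
    by (cases "i = k") auto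
  from partial_eqI[of "\<lambda>v. v k", OF this]
  show "partially_differentiable i (\<lambda>v. v k) u" "partial i (\<lambda>v. v k) = (\<lambda>v. if i = k then 1 else 0)"
    by auto
qed

lemma smooth_on_imp:
  assumes "smooth_on n W g"
  shows smooth_on_imp_continuous: "continuous_map (subtopology (Euclidean_space n) W) euclideanreal g"
    and smooth_on_imp_partially_differentiable: "u \<in> W \<Longrightarrow> i < n \<Longrightarrow> partially_differentiable i g u"
    and smooth_on_partial: "i < n \<Longrightarrow> smooth_on n W (partial i g)"
proof -
  show "continuous_map (subtopology (Euclidean_space n) W) euclideanreal g"
    using assms unfolding smooth_on_def by (auto dest: spec[of _ "[]"])
  show "u \<in> W \<Longrightarrow> i < n \<Longrightarrow> partially_differentiable i g u"
    using assms unfolding smooth_on_def partially_differentiable_def by (auto dest: spec[of _ "[]"])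
  show "smooth_on n W (partial i g)" if "i < n"
    unfolding smooth_on_def
  proof (intro allI impI)
    fix "is" assume "set is \<subseteq> {..<n}"
    then show "continuous_map (subtopology (Euclidean_space n) W) euclideanreal (foldr partial is (partial i g)) \<and>
        (\<forall>u\<in>W. \<forall>k<n. (\<lambda>t. foldr partial is (partial i g) (u(k := t))) differentiable (at (u k)))"
      using assms[unfolded smooth_on_def, rule_format, of "is @ [i]"] that by simp
  qed
qed

text \<open>
  Smoothness is the greatest class of functions that are continuous and partially differentiable and
  that is stable under partial derivatives.
\<close>

lemma smooth_on_coinduct:
  assumes g: "g \<in> C"
    and cont: "\<And>g. g \<in> C \<Longrightarrow> continuous_map (subtopology (Euclidean_space n) W) euclideanreal g"
    and diff: "\<And>g u i. g \<in> C \<Longrightarrow> u \<in> W \<Longrightarrow> i < n \<Longrightarrow> partially_differentiable i g u"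
    and closed: "\<And>g i. g \<in> C \<Longrightarrow> i < n \<Longrightarrow> partial i g \<in> C"
  shows "smooth_on n W g"
proof -
  have "foldr partial is g \<in> C" if "set is \<subseteq> {..<n}" for "is"
    using that by (induction "is") (auto simp: g closed)
  then show ?thesis
    using cont diff unfolding smooth_on_def partially_differentiable_def by blast
qed

text \<open>
  An iterated partial derivative of a product is a sum of products, so a class stable under partial
  derivatives has to contain all polynomial expressions in smooth functions. The rule \<open>cong\<close> is there because
  the product rule determines a partial derivative on \<open>W\<close> only.
\<close>

inductive_set smooth_closure :: "nat \<Rightarrow> (nat \<Rightarrow> real) set \<Rightarrow> ((nat \<Rightarrow> real) \<Rightarrow> real) set"
  for n W where
    smooth: "smooth_on n W g \<Longrightarrow> g \<in> smooth_closure n W"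
  | add: "g \<in> smooth_closure n W \<Longrightarrow> h \<in> smooth_closure n W \<Longrightarrow> (\<lambda>u. g u + h u) \<in> smooth_closure n W"
  | mult: "g \<in> smooth_closure n W \<Longrightarrow> h \<in> smooth_closure n W \<Longrightarrow> (\<lambda>u. g u * h u) \<in> smooth_closure n W"
  | cong: "g \<in> smooth_closure n W \<Longrightarrow> (\<And>u. u \<in> W \<Longrightarrow> g u = h u) \<Longrightarrow> h \<in> smooth_closure n W"

lemma smooth_closure_imp_smooth_on:
  assumes W: "openin (Euclidean_space n) W" and g: "g \<in> smooth_closure n W"
  shows "smooth_on n W g"
proof (rule smooth_on_coinduct[OF g])
  fix g assume "g \<in> smooth_closure n W"
  then show "continuous_map (subtopology (Euclidean_space n) W) euclideanreal g"
  proof induction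
    case (cong g h)
    then show ?case by (auto elim!: continuous_map_eq)
  qed (auto intro: smooth_on_imp_continuous continuous_map_add continuous_map_real_mult)
next
  fix g u i assume "g \<in> smooth_closure n W" and u: "u \<in> W" "i < n"
  from this(1) show "partially_differentiable i g u"
  proof induction
    case (cong g h)
    then show ?case using partial_cong(2)[OF W u] by blast
  qed (auto intro: smooth_on_imp_partially_differentiable partial_add partial_mult u)
next
  fix g i assume "g \<in> smooth_closure n W" and i: "i < n"
  then have "partial i g \<in> smooth_closure n W \<and> (\<forall>u\<in>W. partially_differentiable i g u)"
  proof induction
    case (smooth g)
    then show ?case
      using i by (auto intro: smooth_closure.smooth smooth_on_partial smooth_on_imp_partially_differentiable)
  next
    case (add g h)
    have "(\<lambda>u. partial i g u + partial i h u) \<in> smooth_closure n W"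
      using add by (intro smooth_closure.add) auto
    then show ?case
      using add by (auto simp: partial_add elim!: smooth_closure.cong)
  next
    case (mult g h)
    have "(\<lambda>u. partial i g u * h u + g u * partial i h u) \<in> smooth_closure n W"
      using mult by (intro smooth_closure.add smooth_closure.mult) auto
    then show ?case
      using mult by (auto simp: partial_mult elim!: smooth_closure.cong)
  next
    case (cong g h)
    have "partial i h \<in> smooth_closure n W"
    proof (rule smooth_closure.cong)
      show "partial i g \<in> smooth_closure n W" using cong by simp
      show "partial i g u = partial i h u" if "u \<in> W" for u
        using partial_cong(1)[OF W that i] cong(2) by blast
    qed
    moreover have "partially_differentiable i h u" if "u \<in> W" for u
      using partial_cong(2)[OF W that i, of g h] cong that by blast
    ultimately show ?case by blast
  qed
  then show "partial i g \<in> smooth_closure n W" by simp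
qed

context
  fixes n W assumes W: "openin (Euclidean_space n) W"
begin

lemma smooth_on_cong: "smooth_on n W g \<Longrightarrow> (\<And>u. u \<in> W \<Longrightarrow> g u = h u) \<Longrightarrow> smooth_on n W h"
  by (rule smooth_closure_imp_smooth_on[OF W], rule smooth_closure.cong[OF smooth_closure.smooth])

lemma smooth_on_add: "smooth_on n W g \<Longrightarrow> smooth_on n W h \<Longrightarrow> smooth_on n W (\<lambda>u. g u + h u)"
  by (rule smooth_closure_imp_smooth_on[OF W], intro smooth_closure.add smooth_closure.smooth)

lemma smooth_on_mult: "smooth_on n W g \<Longrightarrow> smooth_on n W h \<Longrightarrow> smooth_on n W (\<lambda>u. g u * h u)"
  by (rule smooth_closure_imp_smooth_on[OF W], intro smooth_closure.mult smooth_closure.smooth)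

end

lemma smooth_on_const: "smooth_on n W (\<lambda>u. r)"
  by (rule smooth_on_coinduct[of _ "{g. \<exists>r. g = (\<lambda>u. r)}"]) (auto simp: partial_const)

lemma smooth_on_sum:
  assumes "openin (Euclidean_space n) W" "\<And>b. b \<in> B \<Longrightarrow> smooth_on n W (g b)"
  shows "smooth_on n W (\<lambda>u. \<Sum>b\<in>B. g b u)"
  using assms(2)
  by (induction B rule: infinite_finite_induct) (auto intro: smooth_on_add[OF assms(1)] smooth_on_const)

lemma smooth_on_coordinate: "smooth_on n W (\<lambda>u. u k)"
proof -
  let ?C = "{g. g = (\<lambda>u. u k) \<or> (\<exists>r. g = (\<lambda>u. r))}"
  have cont: "continuous_map (subtopology (Euclidean_space n) W) euclideanreal (\<lambda>u. u k)"
    unfolding Euclidean_space_def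
    by (intro continuous_map_from_subtopology continuous_map_product_projection) auto
  show ?thesis
    by (rule smooth_on_coinduct[of _ ?C]) (auto simp: cont partial_const partial_coordinate)
qed

section \<open>Paracompactness\<close>

text \<open>
  The topology is that of a subset of the metrizable, second countable space \<open>nat \<Rightarrow> real\<close>, where the
  theorem of Stone is available.
\<close>

lemma paracompact_Euclidean_space: "paracompact_space (Euclidean_space n)"
proof -
  define E where "E = topspace (Euclidean_space n)"
  have eu: "Euclidean_space n = top_of_set E"
    by (simp add: E_def topspace_Euclidean_space) (simp add: Euclidean_space_def euclidean_product_topology)
  show ?thesis
    unfolding paracompact_space_def
  proof (intro allI impI)
    fix \<U> :: "(nat \<Rightarrow> real) set set"
    assume U: "(\<forall>U\<in>\<U>. openin (Euclidean_space n) U) \<and> \<Union>\<U> = topspace (Euclidean_space n)"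
    then have op: "\<And>T. T \<in> \<U> \<Longrightarrow> openin (top_of_set E) T" and cov: "E \<subseteq> \<Union>\<U>"
      by (auto simp: eu)
    show "\<exists>\<V>. (\<forall>V\<in>\<V>. openin (Euclidean_space n) V \<and> (\<exists>U\<in>\<U>. V \<subseteq> U)) \<and>
        \<Union>\<V> = topspace (Euclidean_space n) \<and> locally_finite_in (Euclidean_space n) \<V>"
    proof (rule paracompact_closedin[OF _ op cov])
      fix \<V> assume V: "E \<subseteq> \<Union>\<V>"
        "\<And>V. V \<in> \<V> \<Longrightarrow> openin (top_of_set E) V \<and> (\<exists>T. T \<in> \<U> \<and> V \<subseteq> T)"
        "\<And>x. x \<in> E \<Longrightarrow> \<exists>V. openin (top_of_set E) V \<and> x \<in> V \<and> finite {X. X \<in> \<V> \<and> X \<inter> V \<noteq> {}}"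
      have "\<Union>\<V> = E"
        using V(1,2) openin_subset by fastforce
      then show ?thesis
        using V(2,3) unfolding eu locally_finite_in_def by (intro exI[of _ \<V>]) (simp, blast)
    qed auto
  qed
qed

lemma homeomorphic_paracompact_space:
  assumes f: "homeomorphic_map X Y f" and X: "paracompact_space X"
  shows "paracompact_space Y"
  unfolding paracompact_space_def
proof (intro allI impI)
  fix \<U> assume U: "(\<forall>U\<in>\<U>. openin Y U) \<and> \<Union>\<U> = topspace Y"
  obtain g where g: "homeomorphic_maps X Y f g"
    using f homeomorphic_map_maps by blast
  then have gf: "\<And>x. x \<in> topspace X \<Longrightarrow> g (f x) = x" and fg: "\<And>y. y \<in> topspace Y \<Longrightarrow> f (g y) = y"
    by (auto simp: homeomorphic_maps_def)
  have hg: "homeomorphic_map Y X g"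
    using g homeomorphic_maps_sym homeomorphic_maps_map by blast
  have fX: "f ` topspace X = topspace Y" and gY: "g ` topspace Y = topspace X"
    using f hg by (auto dest: homeomorphic_imp_surjective_map)
  have of: "openin X U \<Longrightarrow> openin Y (f ` U)" for U
    using f homeomorphic_imp_open_map open_map_def by blast
  have og: "openin Y U \<Longrightarrow> openin X (g ` U)" for U
    using hg homeomorphic_imp_open_map open_map_def by blast
  have "(\<forall>U\<in>(`) g ` \<U>. openin X U) \<and> \<Union>((`) g ` \<U>) = topspace X"
    using U og gY by (auto simp flip: image_Union)
  then obtain \<V> where V: "\<And>V. V \<in> \<V> \<Longrightarrow> openin X V \<and> (\<exists>U\<in>\<U>. V \<subseteq> g ` U)"
    "\<Union>\<V> = topspace X" "locally_finite_in X \<V>"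
    using X unfolding paracompact_space_def by (metis (no_types, lifting) imageE)
  have "openin Y (f ` V) \<and> (\<exists>U\<in>\<U>. f ` V \<subseteq> U)" if V': "V \<in> \<V>" for V
  proof -
    obtain U where U': "U \<in> \<U>" "V \<subseteq> g ` U" using V(1) V' by blast
    then have "U \<subseteq> topspace Y" using U by blast
    have "f ` V \<subseteq> U"
    proof
      fix y assume "y \<in> f ` V"
      then obtain u where "u \<in> U" "y = f (g u)" using U'(2) by blast
      then show "y \<in> U" using fg \<open>U \<subseteq> topspace Y\<close> by auto
    qed
    then show ?thesis using U'(1) of V(1) V' by blast
  qed
  moreover have "\<Union>((`) f ` \<V>) = topspace Y"
    using V(2) fX by (simp flip: image_Union)
  moreover have "locally_finite_in Y ((`) f ` \<V>)"
    unfolding locally_finite_in_def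
  proof (intro conjI ballI)
    show "\<Union>((`) f ` \<V>) \<subseteq> topspace Y" using V(2) fX by (simp flip: image_Union)
    fix y assume y: "y \<in> topspace Y"
    then have "g y \<in> topspace X" using gY by blast
    then obtain N where N: "openin X N" "g y \<in> N" "finite {U \<in> \<V>. U \<inter> N \<noteq> {}}"
      using V(3) unfolding locally_finite_in_def by blast
    have inj: "inj_on f (topspace X)" using gf by (rule inj_on_inverseI)
    have "{U \<in> (`) f ` \<V>. U \<inter> f ` N \<noteq> {}} \<subseteq> (`) f ` {U \<in> \<V>. U \<inter> N \<noteq> {}}"
    proof
      fix S assume "S \<in> {U \<in> (`) f ` \<V>. U \<inter> f ` N \<noteq> {}}"
      then obtain V a b where S: "S = f ` V" "V \<in> \<V>" and ab: "a \<in> V" "b \<in> N" "f a = f b"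
        by blast
      then have "a \<in> topspace X" "b \<in> topspace X"
        using V(2) openin_subset[OF N(1)] by auto
      then have "a = b" using inj ab(3) by (auto simp: inj_on_def)
      then show "S \<in> (`) f ` {U \<in> \<V>. U \<inter> N \<noteq> {}}"
        unfolding S(1) using S(2) ab by (intro imageI) auto
    qed
    then have "finite {U \<in> (`) f ` \<V>. U \<inter> f ` N \<noteq> {}}"
      by (rule finite_subset) (intro finite_imageI N(3))
    then show "\<exists>V. openin Y V \<and> y \<in> V \<and> finite {U \<in> (`) f ` \<V>. U \<inter> V \<noteq> {}}"
      using of[OF N(1)] imageI[OF N(2), of f] fg[OF y] by (intro exI[of _ "f ` N"]) simp
  qed
  ultimately show "\<exists>\<V>. (\<forall>V\<in>\<V>. openin Y V \<and> (\<exists>U\<in>\<U>. V \<subseteq> U)) \<and> \<Union>\<V> = topspace Y \<and> locally_finite_in Y \<V>"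
    by (intro exI[of _ "(`) f ` \<V>"]) (simp add: ball_simps)
qed

section \<open>Calculus in the charts of a manifold\<close>

text \<open>
  The chart in which the pairing of covectors and vectors is computed.
\<close>

definition ref_chart :: "'p manifold \<Rightarrow> 'p \<Rightarrow> 'p chart" where
  "ref_chart M p = (SOME c. c \<in> charts_at M p)"

definition chart_differentiable :: "'p chart \<Rightarrow> nat \<Rightarrow> ('p \<Rightarrow> real) \<Rightarrow> 'p \<Rightarrow> bool" where
  "chart_differentiable c i f p \<longleftrightarrow> partially_differentiable i (\<lambda>u. f (cinv c u)) (cmap c p)"

definition anchor_derivative :: "'p manifold \<Rightarrow> 'p gsec \<Rightarrow> ('p \<Rightarrow> real) \<Rightarrow> 'p \<Rightarrow> real" where
  "anchor_derivative M x f p =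
    (\<Sum>j<mdim M. fst (x p) (ref_chart M p) j * cpartial (ref_chart M p) j f p)"

lemma ginner_ref_chart:
  "ginner M p v w = (1 / 2) * (\<Sum>i<mdim M. snd v (ref_chart M p) i * fst w (ref_chart M p) i +
    snd w (ref_chart M p) i * fst v (ref_chart M p) i)"
  by (simp add: ginner_def pairing_def ref_chart_def Let_def sum.distrib)

lemma ginner_commute: "ginner M p v w = ginner M p w v"
  by (simp add: ginner_def)

lemma ginner_gadd: "ginner M p v (gadd w w') = ginner M p v w + ginner M p v w'"
  by (simp add: ginner_ref_chart gadd_def algebra_simps sum.distrib)

lemma ginner_gscale: "ginner M p v (gscale r w) = r * ginner M p v w"
  by (simp add: ginner_ref_chart gscale_def algebra_simps sum_distrib_left)

lemma chart_inverse:
  assumes "smooth_manifold M" "c \<in> atlas M"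
  shows openin_chart_image: "openin (Euclidean_space (mdim M)) (cmap c ` cdom c)"
    and cdom_subset_points: "cdom c \<subseteq> points M"
    and cinv_cmap: "p \<in> cdom c \<Longrightarrow> cinv c (cmap c p) = p"
    and cinv_in_cdom: "u \<in> cmap c ` cdom c \<Longrightarrow> cinv c u \<in> cdom c"
proof -
  have c: "is_chart (mtop M) (mdim M) c"
    using assms by (auto simp: smooth_manifold_def)
  then show "openin (Euclidean_space (mdim M)) (cmap c ` cdom c)" and d: "cdom c \<subseteq> points M"
    by (auto simp: is_chart_def openin_subset)
  have "inj_on (cmap c) (cdom c)"
    using c d homeomorphic_imp_injective_map[of "subtopology (mtop M) (cdom c)"]
    by (auto simp: is_chart_def Int_absorb1)
  then show "p \<in> cdom c \<Longrightarrow> cinv c (cmap c p) = p"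
    by (simp add: cinv_def)
  show "u \<in> cmap c ` cdom c \<Longrightarrow> cinv c u \<in> cdom c"
    by (simp add: cinv_def inv_into_into)
qed

lemma ref_chart_in_charts_at:
  assumes "smooth_manifold M" "p \<in> points M"
  shows "ref_chart M p \<in> charts_at M p"
proof -
  have "p \<in> (\<Union>c\<in>atlas M. cdom c)"
    using assms unfolding smooth_manifold_def by metis
  then have "\<exists>c. c \<in> charts_at M p"
    by (auto simp: charts_at_def)
  then show ?thesis
    unfolding ref_chart_def by (rule someI_ex)
qed

lemma cpartial_cong:
  assumes "smooth_manifold M" "c \<in> charts_at M p" "i < mdim M" and "\<And>q. q \<in> cdom c \<Longrightarrow> f q = g q"
  shows "cpartial c i f p = cpartial c i g p"
  unfolding cpartial_def
  by (rule partial_cong[of "mdim M" "cmap c ` cdom c"])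
    (use assms in \<open>auto simp: charts_at_def openin_chart_image cinv_in_cdom\<close>)

lemma cpartial_add:
  assumes "chart_differentiable c i f p" "chart_differentiable c i g p"
  shows "cpartial c i (\<lambda>q. f q + g q) p = cpartial c i f p + cpartial c i g p"
  using assms by (simp add: cpartial_def chart_differentiable_def partial_add)

lemma cpartial_mult:
  assumes "smooth_manifold M" "c \<in> charts_at M p"
    and "chart_differentiable c i f p" "chart_differentiable c i g p"
  shows "cpartial c i (\<lambda>q. f q * g q) p = cpartial c i f p * g p + f p * cpartial c i g p"
  using assms by (simp add: cpartial_def chart_differentiable_def partial_mult charts_at_def cinv_cmap)

lemma smooth_in_chart_imp_differentiable:
  assumes "smooth_in_chart M c f" "c \<in> charts_at M p" "i < mdim M"
  shows "chart_differentiable c i f p"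
  using assms unfolding smooth_in_chart_def chart_differentiable_def charts_at_def
  by (auto intro: smooth_on_imp_partially_differentiable)

lemma smooth_functions_differentiable:
  assumes "f \<in> smooth_functions M" "c \<in> charts_at M p" "i < mdim M"
  shows "chart_differentiable c i f p"
  using assms smooth_in_chart_imp_differentiable[of M c f p i]
  by (auto simp: smooth_functions_def charts_at_def)

lemma gsections_differentiable:
  assumes "s \<in> gsections M" "c \<in> charts_at M p" "i < mdim M" "j < mdim M"
  shows "chart_differentiable c j (\<lambda>q. fst (s q) c i) p"
    and "chart_differentiable c j (\<lambda>q. snd (s q) c i) p"
proof -
  have "smooth_in_chart M c (\<lambda>p. gcoord M c (s p) a)" if "a < 2 * mdim M" for a
    using assms(1,2) that by (auto simp: gsections_def charts_at_def)
  from this[of i] this[of "i + mdim M"] assms(3)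
  have "smooth_in_chart M c (\<lambda>p. fst (s p) c i)" "smooth_in_chart M c (\<lambda>p. snd (s p) c i)"
    by (auto simp: gcoord_def)
  then show "chart_differentiable c j (\<lambda>q. fst (s q) c i) p"
    and "chart_differentiable c j (\<lambda>q. snd (s q) c i) p"
    using assms by (auto intro: smooth_in_chart_imp_differentiable)
qed

section \<open>The Courant element in a chart\<close>

text \<open>
  The value of the Courant element at a point as a function of the components of its three
  arguments and of their first partial derivatives: \<open>X\<close>, \<open>Y\<close>, \<open>Z\<close> are the tangent components, \<open>\<alpha>\<close>,
  \<open>\<beta>\<close>, \<open>\<zeta>\<close> the cotangent ones, and \<open>DX i j\<close> is the derivative of \<open>X j\<close> along the \<open>i\<close>-th coordinate. It
  separates the index calculations from the calculus.
\<close>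

definition courant_form where
  "courant_form n X DX \<alpha> D\<alpha> Y DY \<beta> D\<beta> Z \<zeta> = (1 / 2 :: real) * (\<Sum>i<n. \<Sum>j<n.
    (X j * D\<beta> j i + \<beta> j * DX i j - Y j * (D\<alpha> j i - D\<alpha> i j)) * Z i + \<zeta> i * (X j * DY j i - Y j * DX j i))"

lemma courant_element_ref_chart:
  assumes M: "smooth_manifold M" and p: "p \<in> points M"
  defines "c \<equiv> ref_chart M p"
  shows "courant_element M x y z p = courant_form (mdim M)
    (fst (x p) c) (\<lambda>j i. cpartial c j (\<lambda>q. fst (x q) c i) p)
    (snd (x p) c) (\<lambda>j i. cpartial c j (\<lambda>q. snd (x q) c i) p)
    (fst (y p) c) (\<lambda>j i. cpartial c j (\<lambda>q. fst (y q) c i) p)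
    (snd (y p) c) (\<lambda>j i. cpartial c j (\<lambda>q. snd (y q) c i) p)
    (fst (z p) c) (snd (z p) c)"
proof -
  have c: "c \<in> charts_at M p"
    unfolding c_def using M p by (rule ref_chart_in_charts_at)
  show ?thesis
    unfolding courant_element_def ginner_ref_chart courant_form_def c_def[symmetric]
    by (intro arg_cong[where f="(*) (1 / 2)"] sum.cong refl)
      (simp add: courant_bracket_def Let_def lie_bracket_def lie_derivative_def interior_d_def
        ext_derivative_def restrict_comps_def c sum.distrib sum_subtractf sum_distrib_right
        sum_distrib_left algebra_simps)
qed

lemma courant_form_cong:
  assumes "\<And>i j. i < n \<Longrightarrow> j < n \<Longrightarrow> DX i j = DX' i j"
    and "\<And>i j. i < n \<Longrightarrow> j < n \<Longrightarrow> D\<alpha> i j = D\<alpha>' i j"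
    and "\<And>i j. i < n \<Longrightarrow> j < n \<Longrightarrow> DY i j = DY' i j"
    and "\<And>i j. i < n \<Longrightarrow> j < n \<Longrightarrow> D\<beta> i j = D\<beta>' i j"
  shows "courant_form n X DX \<alpha> D\<alpha> Y DY \<beta> D\<beta> Z \<zeta> = courant_form n X DX' \<alpha> D\<alpha>' Y DY' \<beta> D\<beta>' Z \<zeta>"
  unfolding courant_form_def
  by (intro arg_cong[where f="(*) (1 / 2)"] sum.cong refl) (simp add: assms)

lemma courant_form_add_1:
  "courant_form n (\<lambda>i. X i + X' i) (\<lambda>i j. DX i j + DX' i j) (\<lambda>i. \<alpha> i + \<alpha>' i) (\<lambda>i j. D\<alpha> i j + D\<alpha>' i j)
      Y DY \<beta> D\<beta> Z \<zeta> =
    courant_form n X DX \<alpha> D\<alpha> Y DY \<beta> D\<beta> Z \<zeta> + courant_form n X' DX' \<alpha>' D\<alpha>' Y DY \<beta> D\<beta> Z \<zeta>"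
  unfolding courant_form_def distrib_left[symmetric] sum.distrib[symmetric]
  by (intro arg_cong[where f="(*) (1 / 2)"] sum.cong refl) (simp add: algebra_simps)

lemma courant_form_add_2:
  "courant_form n X DX \<alpha> D\<alpha> (\<lambda>i. Y i + Y' i) (\<lambda>i j. DY i j + DY' i j) (\<lambda>i. \<beta> i + \<beta>' i) (\<lambda>i j. D\<beta> i j + D\<beta>' i j)
      Z \<zeta> =
    courant_form n X DX \<alpha> D\<alpha> Y DY \<beta> D\<beta> Z \<zeta> + courant_form n X DX \<alpha> D\<alpha> Y' DY' \<beta>' D\<beta>' Z \<zeta>"
  unfolding courant_form_def distrib_left[symmetric] sum.distrib[symmetric]
  by (intro arg_cong[where f="(*) (1 / 2)"] sum.cong refl) (simp add: algebra_simps)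

text \<open>
  The first Leibniz rule in components, with \<open>r\<close> the value and \<open>d\<close> the differential of the scaling function.
  The derivatives of the scaled components obey the product rule; the terms with \<open>d\<close> that remain
  come from \<open>[f X, Y]\<close>, from \<open>L\<^bsub>f X\<^esub> \<beta>\<close> and from \<open>i\<^sub>Y d(f \<alpha>)\<close>, and the summands \<open>\<beta>(X) df\<close> and \<open>\<alpha>(Y) df\<close> combine
  to twice the inner product of the first two arguments.
\<close>

lemma courant_form_scale_1:
  "courant_form n (\<lambda>i. r * X i) (\<lambda>i j. d i * X j + r * DX i j) (\<lambda>i. r * \<alpha> i) (\<lambda>i j. d i * \<alpha> j + r * D\<alpha> i j)
      Y DY \<beta> D\<beta> Z \<zeta> =
    r * courant_form n X DX \<alpha> D\<alpha> Y DY \<beta> D\<beta> Z \<zeta>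
    - (\<Sum>j<n. Y j * d j) * ((1 / 2) * (\<Sum>i<n. \<alpha> i * Z i + \<zeta> i * X i))
    + (\<Sum>i<n. Z i * d i) * ((1 / 2) * (\<Sum>j<n. \<alpha> j * Y j + \<beta> j * X j))"
proof -
  have "(\<Sum>j<n. Y j * d j) * (\<Sum>i<n. \<alpha> i * Z i + \<zeta> i * X i)
      = (\<Sum>i<n. \<Sum>j<n. (Y j * d j) * (\<alpha> i * Z i + \<zeta> i * X i))"
    unfolding sum_product by (rule sum.swap)
  then have 1: "(\<Sum>j<n. Y j * d j) * ((1 / 2) * (\<Sum>i<n. \<alpha> i * Z i + \<zeta> i * X i))
      = (1 / 2) * (\<Sum>i<n. \<Sum>j<n. (Y j * d j) * (\<alpha> i * Z i + \<zeta> i * X i))"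
    by simp
  have 2: "(\<Sum>i<n. Z i * d i) * ((1 / 2) * (\<Sum>j<n. \<alpha> j * Y j + \<beta> j * X j))
      = (1 / 2) * (\<Sum>i<n. \<Sum>j<n. (Z i * d i) * (\<alpha> j * Y j + \<beta> j * X j))"
    by (simp add: sum_product[symmetric])
  show ?thesis
    unfolding 1 2 courant_form_def mult.left_commute[of r "1 / 2"] right_diff_distrib[symmetric]
      distrib_left[symmetric] sum_distrib_left[of r] sum.distrib[symmetric] sum_subtractf[symmetric]
    by (intro arg_cong[where f="(*) (1 / 2)"] sum.cong refl) (simp add: algebra_simps)
qed

text \<open>
  Here every term with \<open>d\<close> differentiates the scaling function along \<open>X\<close>.
\<close>

lemma courant_form_scale_2:
  "courant_form n X DX \<alpha> D\<alpha> (\<lambda>i. r * Y i) (\<lambda>i j. d i * Y j + r * DY i j) (\<lambda>i. r * \<beta> i)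
      (\<lambda>i j. d i * \<beta> j + r * D\<beta> i j) Z \<zeta> =
    r * courant_form n X DX \<alpha> D\<alpha> Y DY \<beta> D\<beta> Z \<zeta>
    + (\<Sum>j<n. X j * d j) * ((1 / 2) * (\<Sum>i<n. \<beta> i * Z i + \<zeta> i * Y i))"
proof -
  have "(\<Sum>j<n. X j * d j) * (\<Sum>i<n. \<beta> i * Z i + \<zeta> i * Y i)
      = (\<Sum>i<n. \<Sum>j<n. (X j * d j) * (\<beta> i * Z i + \<zeta> i * Y i))"
    unfolding sum_product by (rule sum.swap)
  then have 1: "(\<Sum>j<n. X j * d j) * ((1 / 2) * (\<Sum>i<n. \<beta> i * Z i + \<zeta> i * Y i))
      = (1 / 2) * (\<Sum>i<n. \<Sum>j<n. (X j * d j) * (\<beta> i * Z i + \<zeta> i * Y i))"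
    by simp
  show ?thesis
    unfolding 1 courant_form_def mult.left_commute[of r "1 / 2"]
      distrib_left[symmetric] sum_distrib_left[of r] sum.distrib[symmetric]
    by (intro arg_cong[where f="(*) (1 / 2)"] sum.cong refl) (simp add: algebra_simps)
qed

section \<open>Failure of linearity of the Courant element\<close>

text \<open>
  Sections are total functions, and an endomorphism is linear only over the points of the manifold. Identities such
  as \<open>J (f x) = f (J x)\<close> therefore hold only there, which this lemma shows to be enough.
\<close>

lemma courant_element_cong:
  assumes M: "smooth_manifold M" and p: "p \<in> points M"
    and "\<And>q. q \<in> points M \<Longrightarrow> x q = x' q" "\<And>q. q \<in> points M \<Longrightarrow> y q = y' q" "z p = z' p"
  shows "courant_element M x y z p = courant_element M x' y' z' p"
proof -
  define c where "c = ref_chart M p"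
  have c: "c \<in> charts_at M p"
    unfolding c_def using M p by (rule ref_chart_in_charts_at)
  then have "cdom c \<subseteq> points M"
    by (intro cdom_subset_points[OF M]) (simp add: charts_at_def)
  then show ?thesis
    unfolding courant_element_ref_chart[OF M p] c_def[symmetric] assms(3)[OF p] assms(4)[OF p] assms(5)
    by (intro courant_form_cong cpartial_cong[OF M c]) (auto simp: assms)
qed

context
  fixes M :: "'p manifold" and p
  assumes M: "smooth_manifold M" and p: "p \<in> points M"
begin

lemma courant_element_add_1:
  assumes "x \<in> gsections M" "w \<in> gsections M"
  shows "courant_element M (sec_add x w) y z p = courant_element M x y z p + courant_element M w y z p"
proof -
  note c = ref_chart_in_charts_at[OF M p]
  show ?thesis
    unfolding courant_element_ref_chart[OF M p] courant_form_add_1[symmetric] sec_add_def gadd_def fst_conv snd_conv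
    by (rule courant_form_cong) (auto intro!: cpartial_add gsections_differentiable assms c)
qed

lemma courant_element_add_2:
  assumes "y \<in> gsections M" "w \<in> gsections M"
  shows "courant_element M x (sec_add y w) z p = courant_element M x y z p + courant_element M x w z p"
proof -
  note c = ref_chart_in_charts_at[OF M p]
  show ?thesis
    unfolding courant_element_ref_chart[OF M p] courant_form_add_2[symmetric] sec_add_def gadd_def fst_conv snd_conv
    by (rule courant_form_cong) (auto intro!: cpartial_add gsections_differentiable assms c)
qed

lemma courant_element_add_3:
  "courant_element M x y (sec_add z w) p = courant_element M x y z p + courant_element M x y w p"
  by (simp add: courant_element_def sec_add_def ginner_gadd)

lemma courant_element_scale_1:
  assumes "x \<in> gsections M" "f \<in> smooth_functions M"
  shows "courant_element M (sec_scale f x) y z p = f p * courant_element M x y z p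
    - anchor_derivative M y f p * ginner M p (x p) (z p)
    + anchor_derivative M z f p * ginner M p (x p) (y p)"
proof -
  note c = ref_chart_in_charts_at[OF M p]
  show ?thesis
    unfolding courant_element_ref_chart[OF M p] anchor_derivative_def ginner_ref_chart
      courant_form_scale_1[symmetric] sec_scale_def gscale_def fst_conv snd_conv
    by (rule courant_form_cong)
      (auto intro!: cpartial_mult[OF M c] gsections_differentiable[OF assms(1) c]
        smooth_functions_differentiable[OF assms(2) c])
qed

lemma courant_element_scale_2:
  assumes "y \<in> gsections M" "f \<in> smooth_functions M"
  shows "courant_element M x (sec_scale f y) z p = f p * courant_element M x y z p
    + anchor_derivative M x f p * ginner M p (y p) (z p)"
proof -
  note c = ref_chart_in_charts_at[OF M p]
  show ?thesis
    unfolding courant_element_ref_chart[OF M p] anchor_derivative_def ginner_ref_chart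
      courant_form_scale_2[symmetric] sec_scale_def gscale_def fst_conv snd_conv
    by (rule courant_form_cong)
      (auto intro!: cpartial_mult[OF M c] gsections_differentiable[OF assms(1) c]
        smooth_functions_differentiable[OF assms(2) c])
qed

lemma courant_element_scale_3:
  "courant_element M x y (sec_scale f z) p = f p * courant_element M x y z p"
  by (simp add: courant_element_def sec_scale_def ginner_gscale)

end

section \<open>Powers of an endomorphism acting on sections\<close>

lemma act_pow_apply: "(act J ^^ i) s p = (J p ^^ i) (s p)"
  by (induction i) (simp_all add: act_def)

context
  fixes M :: "'p manifold" and J
  assumes M: "smooth_manifold M" and J: "bundle_endomorphism M J"
begin

text \<open>
  In a chart the components of the image are sums of products of smooth functions. Skewness is a
  statement about smooth sections, so this is what permits applying it to powers of \<open>J\<close>.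
\<close>

lemma act_gsections:
  assumes s: "s \<in> gsections M"
  shows "act J s \<in> gsections M"
  unfolding gsections_def
proof (intro CollectI conjI ballI allI impI)
  fix p assume "p \<in> points M"
  then show "act J s p \<in> gfibre M p"
    using s J by (auto simp: gsections_def act_def bundle_endomorphism_def)
next
  fix c a assume c: "c \<in> atlas M" and a: "a < 2 * mdim M"
  from J c obtain A :: "nat \<Rightarrow> nat \<Rightarrow> 'p \<Rightarrow> real"
    where A: "\<forall>a<2 * mdim M. \<forall>b<2 * mdim M. smooth_in_chart M c (A a b)"
      and JA: "\<forall>p\<in>cdom c. \<forall>v\<in>gfibre M p. \<forall>a<2 * mdim M.
        gcoord M c (J p v) a = (\<Sum>b<2 * mdim M. A a b p * gcoord M c v b)"
    unfolding bundle_endomorphism_def by blast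
  have W: "openin (Euclidean_space (mdim M)) (cmap c ` cdom c)"
    using M c by (rule openin_chart_image)
  have "smooth_on (mdim M) (cmap c ` cdom c)
      (\<lambda>u. \<Sum>b<2 * mdim M. A a b (cinv c u) * gcoord M c (s (cinv c u)) b)"
    using A s a c unfolding smooth_in_chart_def gsections_def
    by (intro smooth_on_sum smooth_on_mult W) auto
  then show "smooth_in_chart M c (\<lambda>p. gcoord M c (act J s p) a)"
    unfolding smooth_in_chart_def
  proof (rule smooth_on_cong[OF W])
    fix u assume "u \<in> cmap c ` cdom c"
    then have u: "cinv c u \<in> cdom c" using cinv_in_cdom[OF M c] by blast
    then have "s (cinv c u) \<in> gfibre M (cinv c u)"
      using s cdom_subset_points[OF M c] by (auto simp: gsections_def)
    then show "(\<Sum>b<2 * mdim M. A a b (cinv c u) * gcoord M c (s (cinv c u)) b) =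
        gcoord M c (act J s (cinv c u)) a"
      using JA u a by (simp add: act_def)
  qed
qed

lemma act_pow_gsections: "s \<in> gsections M \<Longrightarrow> (act J ^^ i) s \<in> gsections M"
  by (induction i) (auto intro: act_gsections)

lemma endomorphism_pow:
  assumes "p \<in> points M" "v \<in> gfibre M p"
  shows endomorphism_pow_gadd: "w \<in> gfibre M p \<Longrightarrow> (J p ^^ i) (gadd v w) = gadd ((J p ^^ i) v) ((J p ^^ i) w)"
    and endomorphism_pow_gscale: "(J p ^^ i) (gscale r v) = gscale r ((J p ^^ i) v)"
proof -
  have fibre: "(J p ^^ i) v \<in> gfibre M p" if "v \<in> gfibre M p" for v i
    by (induction i) (use that assms(1) J in \<open>auto simp: bundle_endomorphism_def\<close>)
  show "w \<in> gfibre M p \<Longrightarrow> (J p ^^ i) (gadd v w) = gadd ((J p ^^ i) v) ((J p ^^ i) w)"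
    by (induction i) (use assms J fibre in \<open>auto simp: bundle_endomorphism_def\<close>)
  show "(J p ^^ i) (gscale r v) = gscale r ((J p ^^ i) v)"
    by (induction i) (use assms J fibre in \<open>auto simp: bundle_endomorphism_def\<close>)
qed

lemma act_pow_sec_add:
  assumes "s \<in> gsections M" "t \<in> gsections M" "p \<in> points M"
  shows "(act J ^^ i) (sec_add s t) p = sec_add ((act J ^^ i) s) ((act J ^^ i) t) p"
  using assms by (simp add: act_pow_apply sec_add_def endomorphism_pow_gadd gsections_def)

lemma act_pow_sec_scale:
  assumes "s \<in> gsections M" "p \<in> points M"
  shows "(act J ^^ i) (sec_scale f s) p = sec_scale f ((act J ^^ i) s) p"
  using assms by (simp add: act_pow_apply sec_scale_def endomorphism_pow_gscale gsections_def)

text \<open>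
  The hypothesis of \<open>monomial_sum_eq_0\<close> for an array of inner products.
\<close>

lemma skew_shift:
  assumes "skew M J" "x \<in> gsections M" "y \<in> gsections M" "p \<in> points M"
  shows "ginner M p ((act J ^^ Suc i) x p) ((act J ^^ j) y p) +
    ginner M p ((act J ^^ i) x p) ((act J ^^ Suc j) y p) = 0"
  using assms act_pow_gsections[of x i] act_pow_gsections[of y j]
  unfolding skew_def by simp

context
  fixes p x y z
  assumes p: "p \<in> points M"
    and x: "x \<in> gsections M" and y: "y \<in> gsections M" and z: "z \<in> gsections M"
begin

lemma poly_action_add:
  assumes w: "w \<in> gsections M"
  shows "poly_action P J (courant_element M) (sec_add x w) y z p =
      poly_action P J (courant_element M) x y z p + poly_action P J (courant_element M) w y z p"
    and "poly_action P J (courant_element M) x (sec_add y w) z p =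
      poly_action P J (courant_element M) x y z p + poly_action P J (courant_element M) x w z p"
    and "poly_action P J (courant_element M) x y (sec_add z w) p =
      poly_action P J (courant_element M) x y z p + poly_action P J (courant_element M) x y w p"
  unfolding poly_action_eq_monomial_sum monomial_sum_plus[symmetric]
  subgoal
    by (subst courant_element_add_1[OF M p, symmetric])
      (auto intro!: arg_cong[where f="monomial_sum P"] ext courant_element_cong[OF M p] act_pow_sec_add
        act_pow_gsections x y z w p)
  subgoal
    by (subst courant_element_add_2[OF M p, symmetric])
      (auto intro!: arg_cong[where f="monomial_sum P"] ext courant_element_cong[OF M p] act_pow_sec_add
        act_pow_gsections x y z w p)
  subgoal
    by (subst courant_element_add_3[OF M p, symmetric])
      (auto intro!: arg_cong[where f="monomial_sum P"] ext courant_element_cong[OF M p] act_pow_sec_add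
        act_pow_gsections x y z w p)
  done

text \<open>
  The defect of the first argument, summed over the monomials of the polynomial: the powers of \<open>J\<close> commute with
  the scaling, so the Leibniz rule applies to each monomial.
\<close>

lemma poly_action_scale_1:
  assumes f: "f \<in> smooth_functions M"
  shows "poly_action P J (courant_element M) (sec_scale f x) y z p =
      f p * poly_action P J (courant_element M) x y z p
      - monomial_sum P (\<lambda>i j k. anchor_derivative M ((act J ^^ j) y) f p *
          ginner M p ((act J ^^ i) x p) ((act J ^^ k) z p))
      + monomial_sum P (\<lambda>i j k. anchor_derivative M ((act J ^^ k) z) f p *
          ginner M p ((act J ^^ i) x p) ((act J ^^ j) y p))"
proof -
  have *: "courant_element M ((act J ^^ i) (sec_scale f x)) ((act J ^^ j) y) ((act J ^^ k) z) p =
      f p * courant_element M ((act J ^^ i) x) ((act J ^^ j) y) ((act J ^^ k) z) p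
      + ((- 1) * (anchor_derivative M ((act J ^^ j) y) f p * ginner M p ((act J ^^ i) x p) ((act J ^^ k) z p))
      + anchor_derivative M ((act J ^^ k) z) f p * ginner M p ((act J ^^ i) x p) ((act J ^^ j) y p))"
    for i j k
  proof -
    have "courant_element M ((act J ^^ i) (sec_scale f x)) ((act J ^^ j) y) ((act J ^^ k) z) p =
        courant_element M (sec_scale f ((act J ^^ i) x)) ((act J ^^ j) y) ((act J ^^ k) z) p"
      by (rule courant_element_cong[OF M p]) (auto intro: act_pow_sec_scale x)
    then show ?thesis
      by (simp add: courant_element_scale_1[OF M p] act_pow_gsections x f)
  qed
  show ?thesis
    unfolding poly_action_eq_monomial_sum * monomial_sum_plus monomial_sum_scale by simp
qed

lemma poly_action_scale_2:
  assumes f: "f \<in> smooth_functions M"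
  shows "poly_action P J (courant_element M) x (sec_scale f y) z p =
      f p * poly_action P J (courant_element M) x y z p
      + monomial_sum P (\<lambda>i j k. anchor_derivative M ((act J ^^ i) x) f p *
          ginner M p ((act J ^^ j) y p) ((act J ^^ k) z p))"
proof -
  have *: "courant_element M ((act J ^^ i) x) ((act J ^^ j) (sec_scale f y)) ((act J ^^ k) z) p =
      f p * courant_element M ((act J ^^ i) x) ((act J ^^ j) y) ((act J ^^ k) z) p
      + anchor_derivative M ((act J ^^ i) x) f p * ginner M p ((act J ^^ j) y p) ((act J ^^ k) z p)"
    for i j k
  proof -
    have "courant_element M ((act J ^^ i) x) ((act J ^^ j) (sec_scale f y)) ((act J ^^ k) z) p =
        courant_element M ((act J ^^ i) x) (sec_scale f ((act J ^^ j) y)) ((act J ^^ k) z) p"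
      by (rule courant_element_cong[OF M p]) (auto intro: act_pow_sec_scale y)
    then show ?thesis
      by (simp add: courant_element_scale_2[OF M p] act_pow_gsections y f)
  qed
  show ?thesis
    unfolding poly_action_eq_monomial_sum * monomial_sum_plus monomial_sum_scale by simp
qed

lemma poly_action_scale_3:
  "poly_action P J (courant_element M) x y (sec_scale f z) p =
      f p * poly_action P J (courant_element M) x y z p"
proof -
  have *: "courant_element M ((act J ^^ i) x) ((act J ^^ j) y) ((act J ^^ k) (sec_scale f z)) p =
      f p * courant_element M ((act J ^^ i) x) ((act J ^^ j) y) ((act J ^^ k) z) p"
    for i j k
    unfolding courant_element_scale_3[OF M p, symmetric]
    by (rule courant_element_cong[OF M p]) (auto intro: act_pow_sec_scale z p)
  show ?thesis
    unfolding poly_action_eq_monomial_sum * monomial_sum_scale by simp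
qed

end

end

section \<open>Multiples of the three linear forms are tensorial\<close>

text \<open>
  Each of the three defects contains an inner product that is annihilated by one of the three factors;
  the other two factors are carried along.
\<close>

lemma tensorial_if_dvd:
  assumes "(var_y + var_z) * (var_z + var_x) * (var_x + var_y) dvd P"
  shows "tensorial TYPE('p) P"
  unfolding tensorial_def tensorial_pair_def smooth_trilinear_def
proof (intro allI impI conjI ballI; elim conjE)
  fix M :: "'p manifold" and J x y z w f p
  assume M: "smooth_manifold M" and J: "bundle_endomorphism M J" and "skew M J"
    and x: "x \<in> gsections M" and y: "y \<in> gsections M" and z: "z \<in> gsections M"
    and w: "w \<in> gsections M" and f: "f \<in> smooth_functions M" and p: "p \<in> points M"
  note shift = skew_shift[OF M J \<open>skew M J\<close> _ _ p]
  obtain Q where Q: "P = (var_y + var_z) * (var_z + var_x) * (var_x + var_y) * Q"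
    using assms by (rule dvdE)
  \<comment> \<open>One factorization for each of the inner products \<open>\<langle>y, z\<rangle>\<close>, \<open>\<langle>x, z\<rangle>\<close> and \<open>\<langle>x, y\<rangle>\<close>.\<close>
  have yz: "P = (var_y + var_z) * ((var_z + var_x) * (var_x + var_y) * Q)"
    and zx: "P = (var_z + var_x) * ((var_y + var_z) * (var_x + var_y) * Q)"
    and xy: "P = (var_x + var_y) * ((var_y + var_z) * (var_z + var_x) * Q)"
    unfolding Q by (simp_all only: mult_ac)
  show "poly_action P J (courant_element M) (sec_add x w) y z p =
      poly_action P J (courant_element M) x y z p + poly_action P J (courant_element M) w y z p"
    "poly_action P J (courant_element M) x (sec_add y w) z p =
      poly_action P J (courant_element M) x y z p + poly_action P J (courant_element M) x w z p"
    "poly_action P J (courant_element M) x y (sec_add z w) p =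
      poly_action P J (courant_element M) x y z p + poly_action P J (courant_element M) x y w p"
    by (rule poly_action_add[OF M J p x y z w])+
  have "monomial_sum P (\<lambda>i j k. anchor_derivative M ((act J ^^ i) x) f p *
      ginner M p ((act J ^^ j) y p) ((act J ^^ k) z p)) = 0"
    unfolding yz by (rule monomial_sum_eq_0) (simp add: shift[OF y z] flip: distrib_left del: funpow.simps)
  then show "poly_action P J (courant_element M) x (sec_scale f y) z p =
      f p * poly_action P J (courant_element M) x y z p"
    by (simp add: poly_action_scale_2[OF M J p x y z f])
  have shift_zx: "ginner M p ((act J ^^ i) x p) ((act J ^^ Suc k) z p) +
      ginner M p ((act J ^^ Suc i) x p) ((act J ^^ k) z p) = 0" for i k
    using shift[OF x z, of i k] by linarith
  have "monomial_sum P (\<lambda>i j k. anchor_derivative M ((act J ^^ j) y) f p *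
      ginner M p ((act J ^^ i) x p) ((act J ^^ k) z p)) = 0"
    unfolding zx by (rule monomial_sum_eq_0)
      (simp add: shift_zx flip: distrib_left del: funpow.simps)
  moreover have "monomial_sum P (\<lambda>i j k. anchor_derivative M ((act J ^^ k) z) f p *
      ginner M p ((act J ^^ i) x p) ((act J ^^ j) y p)) = 0"
    unfolding xy by (rule monomial_sum_eq_0) (simp add: shift[OF x y] flip: distrib_left del: funpow.simps)
  ultimately show "poly_action P J (courant_element M) (sec_scale f x) y z p =
      f p * poly_action P J (courant_element M) x y z p"
    by (simp add: poly_action_scale_1[OF M J p x y z f])
  show "poly_action P J (courant_element M) x y (sec_scale f z) p =
      f p * poly_action P J (courant_element M) x y z p"
    by (rule poly_action_scale_3[OF M J p x y z])
qed

section \<open>Diagonal endomorphisms and their eigensections\<close>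

text \<open>
  The endomorphism \<open>A \<oplus> (- A\<^sup>T)\<close> for the diagonal matrix \<open>A\<close> with entries \<open>D\<close>; the sign on the covectors makes it
  skew.
\<close>

definition diagonal_endomorphism :: "(nat \<Rightarrow> real) \<Rightarrow> 'p \<Rightarrow> 'p gvec \<Rightarrow> 'p gvec" where
  "diagonal_endomorphism D p v = ((\<lambda>c i. D i * fst v c i), (\<lambda>c i. - D i * snd v c i))"

text \<open>
  In every chart this is the multiple by \<open>r\<close> of the \<open>m\<close>-th coordinate vector field. Different charts would disagree
  about it, but it is used only on manifolds with a single chart.
\<close>

definition vector_section :: "'p manifold \<Rightarrow> real \<Rightarrow> nat \<Rightarrow> 'p gsec" where
  "vector_section M r m p = ((\<lambda>c i. if c \<in> atlas M \<and> i < mdim M \<and> i = m then r else 0), (\<lambda>c i. 0))"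

definition covector_section :: "'p manifold \<Rightarrow> real \<Rightarrow> nat \<Rightarrow> 'p gsec" where
  "covector_section M r m p = ((\<lambda>c i. 0), (\<lambda>c i. if c \<in> atlas M \<and> i < mdim M \<and> i = m then r else 0))"

lemma act_diagonal_vector_section:
  "(act (diagonal_endomorphism D) ^^ k) (vector_section M r m) = vector_section M (D m ^ k * r) m"
  by (induction k) (auto simp: act_def diagonal_endomorphism_def vector_section_def fun_eq_iff)

lemma act_diagonal_covector_section:
  "(act (diagonal_endomorphism D) ^^ k) (covector_section M r m) = covector_section M ((- D m) ^ k * r) m"
  by (induction k) (auto simp: act_def diagonal_endomorphism_def covector_section_def fun_eq_iff)

lemma skew_diagonal_endomorphism: "skew M (diagonal_endomorphism D)"
  unfolding skew_def ginner_ref_chart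
  by (auto simp: act_def diagonal_endomorphism_def sum_negf[symmetric] intro!: sum.cong)

section \<open>Copies of Euclidean space\<close>

text \<open>
  Euclidean space with its points renamed by \<open>e\<close>, covered by the single chart inverse to \<open>e\<close>.
\<close>

definition euclidean_copy :: "nat \<Rightarrow> ((nat \<Rightarrow> real) \<Rightarrow> 'p) \<Rightarrow> 'p manifold" where
  "euclidean_copy n e = (let E = topspace (Euclidean_space n) in
    \<lparr>mtop = pullback_topology (e ` E) (inv_into E e) (Euclidean_space n), mdim = n,
     atlas = {(e ` E, inv_into E e)}\<rparr>)"

context
  fixes n :: nat and e :: "(nat \<Rightarrow> real) \<Rightarrow> 'p" and E and M :: "'p manifold" and c :: "'p chart"
  defines "E \<equiv> topspace (Euclidean_space n)" and "M \<equiv> euclidean_copy n e"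
    and "c \<equiv> (e ` E, inv_into E e)"
  assumes inj: "inj_on e E"
begin

lemma copy_simps: "mdim M = n" "atlas M = {c}" "cdom c = e ` E" "cmap c = inv_into E e"
  "mtop M = pullback_topology (e ` E) (inv_into E e) (Euclidean_space n)"
  by (simp_all add: M_def euclidean_copy_def E_def c_def Let_def)

lemma points_copy: "points M = e ` E"
  unfolding copy_simps topspace_pullback_topology
  by (auto simp: inv_into_into E_def[symmetric])

lemma charts_at_copy: "p \<in> points M \<Longrightarrow> charts_at M p = {c}"
  unfolding charts_at_def copy_simps(2) using points_copy copy_simps(3) by auto

lemma ref_chart_copy: "p \<in> points M \<Longrightarrow> ref_chart M p = c"
  by (simp add: ref_chart_def charts_at_copy)

lemma cmap_copy: "u \<in> E \<Longrightarrow> cmap c (e u) = u"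
  by (simp add: copy_simps inj)

lemma cmap_image_copy: "cmap c ` cdom c = E"
  by (simp add: copy_simps inj)

lemma cinv_copy: "u \<in> E \<Longrightarrow> cinv c u = e u"
  unfolding cinv_def copy_simps
  using inv_into_f_f[of "inv_into E e" "e ` E" "e u"] by (simp add: inj inj_on_inv_into)

lemma openin_E: "openin (Euclidean_space n) E"
  by (simp add: E_def)

lemma smooth_in_chart_copyI: "smooth_on n E (\<lambda>u. f (e u)) \<Longrightarrow> smooth_in_chart M c f"
  unfolding smooth_in_chart_def cmap_image_copy copy_simps(1)
  by (rule smooth_on_cong[OF openin_E]) (simp_all add: cinv_copy)

lemma cpartial_copy:
  assumes "u \<in> E" "i < n"
  shows "cpartial c i f (e u) = partial i (\<lambda>u. f (e u)) u"
  unfolding cpartial_def cmap_copy[OF assms(1)]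
  by (rule partial_cong[OF openin_E assms]) (simp add: cinv_copy)

text \<open>
  The only transition map is the identity, so its Jacobian is the unit matrix. The transformation laws of tangent
  and cotangent vectors then become void, as \<open>gfibre_copy\<close> records.
\<close>

lemma cpartial_coordinate_copy:
  assumes "p \<in> points M" "i < n"
  shows "cpartial c i (\<lambda>q. cmap c q k) p = (if i = k then 1 else 0)"
proof -
  obtain u where u: "p = e u" "u \<in> E"
    using assms(1) by (auto simp: points_copy)
  have "cpartial c i (\<lambda>q. cmap c q k) p = partial i (\<lambda>u. cmap c (e u) k) u"
    unfolding u(1) by (rule cpartial_copy[OF u(2) assms(2)])
  also have "\<dots> = partial i (\<lambda>u. u k) u"
    by (rule partial_cong[OF openin_E u(2) assms(2)]) (simp add: cmap_copy)
  finally show ?thesis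
    by (simp add: partial_coordinate)
qed

lemma homeomorphic_maps_copy: "homeomorphic_maps (mtop M) (Euclidean_space n) (cmap c) e"
proof -
  have "continuous_map (mtop M) (Euclidean_space n) (cmap c)"
    using continuous_map_pullback[of "Euclidean_space n" "Euclidean_space n" id "e ` E" "inv_into E e"]
    by (simp add: copy_simps)
  moreover have "continuous_map (Euclidean_space n) (Euclidean_space n) (inv_into E e \<circ> e)"
    by (rule continuous_map_eq[of _ _ id]) (auto simp: inj E_def[symmetric])
  then have "continuous_map (Euclidean_space n) (mtop M) e"
    unfolding copy_simps by (rule continuous_map_pullback') (auto simp: E_def)
  ultimately show ?thesis
    unfolding homeomorphic_maps_def points_copy E_def[symmetric] by (auto simp: cmap_copy)
qed

lemma smooth_manifold_copy: "smooth_manifold M"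
proof -
  have h: "homeomorphic_map (mtop M) (Euclidean_space n) (cmap c)"
    and h': "homeomorphic_map (Euclidean_space n) (mtop M) e"
    using homeomorphic_maps_copy by (auto simp: homeomorphic_maps_map)
  have "Hausdorff_space (mtop M)"
    using homeomorphic_maps_copy Hausdorff_Euclidean_space homeomorphic_Hausdorff_space
    unfolding homeomorphic_space_def by blast
  moreover have "paracompact_space (mtop M)"
    using h' paracompact_Euclidean_space by (rule homeomorphic_paracompact_space)
  moreover have "cdom c = points M"
    by (simp add: points_copy copy_simps(3))
  moreover have "is_chart (mtop M) n c"
    unfolding is_chart_def cmap_image_copy
    using h \<open>cdom c = points M\<close> by (simp add: openin_E) (simp add: E_def)
  moreover have "smooth_on n (cmap c ` (cdom c \<inter> cdom c)) (\<lambda>u. cmap c (cinv c u) i)" for i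
    unfolding Int_absorb cmap_image_copy
    by (rule smooth_on_cong[OF openin_E, of "\<lambda>u. u i"]) (simp_all add: smooth_on_coordinate cinv_copy cmap_copy)
  ultimately show ?thesis
    unfolding smooth_manifold_def copy_simps(1,2) by blast
qed

lemma gfibre_copy:
  assumes "p \<in> points M"
  shows "v \<in> gfibre M p \<longleftrightarrow> supported_at M p (fst v) \<and> supported_at M p (snd v)"
proof -
  have 1: "(\<Sum>j<n. (if j = i then 1 else 0) * w j) = w i" "(\<Sum>j<n. (if i = j then 1 else 0) * w j) = w i"
    if "i < n" for i and w :: "nat \<Rightarrow> real"
    using that by (simp_all add: if_distrib[of "\<lambda>r. r * _"] cong: if_cong)
  show ?thesis
    using assms
    by (auto simp: gfibre_def mem_Times_iff tangent_space_def cotangent_space_def charts_at_copy copy_simps(1)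
        cpartial_coordinate_copy 1)
qed

lemma sections_copy: "vector_section M r m \<in> gsections M" "covector_section M r m \<in> gsections M"
proof -
  have "gcoord M c (vector_section M r m p) a = (if a < n \<and> a = m then r else 0)"
    and "gcoord M c (covector_section M r m p) a = (if n \<le> a \<and> a - n < n \<and> a - n = m then r else 0)" for a p
    by (auto simp: gcoord_def vector_section_def covector_section_def copy_simps(1,2))
  then have "smooth_in_chart M c (\<lambda>p. gcoord M c (vector_section M r m p) a)"
    and "smooth_in_chart M c (\<lambda>p. gcoord M c (covector_section M r m p) a)" for a
    by (auto intro: smooth_in_chart_copyI smooth_on_const)
  moreover have "vector_section M r m p \<in> gfibre M p" "covector_section M r m p \<in> gfibre M p"
    if "p \<in> points M" for p
    using that by (auto simp: gfibre_copy supported_at_def charts_at_copy vector_section_def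
        covector_section_def copy_simps(1,2))
  ultimately show "vector_section M r m \<in> gsections M" "covector_section M r m \<in> gsections M"
    by (simp_all add: gsections_def copy_simps(2))
qed

lemma coordinate_copy: "(\<lambda>p. cmap c p k) \<in> smooth_functions M"
proof -
  have "smooth_on n E (\<lambda>u. cmap c (e u) k)"
    by (rule smooth_on_cong[OF openin_E smooth_on_coordinate[of _ _ k]]) (simp add: cmap_copy)
  then show ?thesis
    by (simp add: smooth_functions_def copy_simps(2) smooth_in_chart_copyI)
qed

text \<open>
  The matrix of the endomorphism in the chart is constant and diagonal: \<open>D\<close> on the first \<open>n\<close> fibre coordinates
  and \<open>- D\<close> on the last \<open>n\<close>.
\<close>

lemma bundle_endomorphism_copy: "bundle_endomorphism M (diagonal_endomorphism D)"
proof -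
  let ?d = "\<lambda>a. if a < n then D a else - D (a - n)"
  have "\<exists>A. (\<forall>a<2 * n. \<forall>b<2 * n. smooth_in_chart M c (A a b)) \<and>
      (\<forall>p\<in>cdom c. \<forall>v\<in>gfibre M p. \<forall>a<2 * n.
        gcoord M c (diagonal_endomorphism D p v) a = (\<Sum>b<2 * n. A a b p * gcoord M c v b))"
  proof (intro exI[of _ "\<lambda>a b p. if b = a then ?d a else 0"] conjI allI ballI impI)
    show "smooth_in_chart M c (\<lambda>p. if b = a then ?d a else 0)" for a b
      by (intro smooth_in_chart_copyI smooth_on_const)
    fix p v a assume "a < 2 * n"
    have "(\<Sum>b<2 * n. (if b = a then ?d a else 0) * gcoord M c v b)
        = (\<Sum>b<2 * n. if b = a then ?d a * gcoord M c v b else 0)"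
      by (intro sum.cong) auto
    also have "\<dots> = ?d a * gcoord M c v a"
      using \<open>a < 2 * n\<close> by (subst sum.delta) auto
    finally show "gcoord M c (diagonal_endomorphism D p v) a
        = (\<Sum>b<2 * n. (if b = a then ?d a else 0) * gcoord M c v b)"
      by (simp add: gcoord_def diagonal_endomorphism_def copy_simps(1))
  qed
  then show ?thesis
    unfolding bundle_endomorphism_def copy_simps(1,2)
    by (auto simp: gfibre_copy supported_at_def diagonal_endomorphism_def gadd_def gscale_def fun_eq_iff
        algebra_simps)
qed

context
  fixes p assumes p: "p \<in> points M"
begin

lemma anchor_derivative_copy:
  "m < n \<Longrightarrow> anchor_derivative M (vector_section M r m) f p = r * cpartial c m f p"
  "anchor_derivative M (covector_section M r m) f p = 0"
proof -
  assume "m < n"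
  have "anchor_derivative M (vector_section M r m) f p = (\<Sum>j<n. if j = m then r * cpartial c j f p else 0)"
    unfolding anchor_derivative_def ref_chart_copy[OF p] copy_simps(1)
    by (intro sum.cong) (auto simp: vector_section_def copy_simps(1,2))
  also have "\<dots> = r * cpartial c m f p"
    using \<open>m < n\<close> by (subst sum.delta) auto
  finally show "anchor_derivative M (vector_section M r m) f p = r * cpartial c m f p" .
qed (simp add: anchor_derivative_def covector_section_def)

lemma ginner_copy:
  assumes "m < n"
  shows "ginner M p (vector_section M r m p) (covector_section M s m p) = r * s / 2"
    and "ginner M p (covector_section M s m p) (vector_section M r m p) = r * s / 2"
proof -
  have "ginner M p (vector_section M r m p) (covector_section M s m p)
      = (1 / 2) * (\<Sum>i<n. if i = m then r * s else 0)"
    unfolding ginner_ref_chart ref_chart_copy[OF p] copy_simps(1)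
    by (intro arg_cong[where f="(*) (1 / 2)"] sum.cong)
      (auto simp: vector_section_def covector_section_def copy_simps(1,2))
  then show "ginner M p (vector_section M r m p) (covector_section M s m p) = r * s / 2"
    using assms by simp
  then show "ginner M p (covector_section M s m p) (vector_section M r m p) = r * s / 2"
    by (simp add: ginner_commute)
qed

end

text \<open>
  Let \<open>\<partial>\<^sub>0\<close> and \<open>\<partial>\<^sub>1\<close> be coordinate fields with eigenvalues \<open>a\<close> and \<open>b\<close>, and \<open>du\<^sub>1\<close> the covector field dual to \<open>\<partial>\<^sub>1\<close>, with
  eigenvalue \<open>- b\<close>. The coordinate \<open>f = u\<^sub>0\<close> is differentiated to \<open>1\<close> by \<open>\<partial>\<^sub>0\<close> and to \<open>0\<close> by \<open>\<pi>(du\<^sub>1)\<close>, and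
  \<open>\<langle>\<partial>\<^sub>1, du\<^sub>1\<rangle> = 1/2\<close>. Putting \<open>\<partial>\<^sub>0\<close> in the slot that differentiates \<open>f\<close> and the pair \<open>\<partial>\<^sub>1\<close>, \<open>du\<^sub>1\<close> in the other
  two leaves a single defect, half the value of \<open>P\<close> at the three eigenvalues.
\<close>

lemma tensorial_eval3_eq_0:
  fixes P
  assumes P: "tensorial TYPE('p) P" and n: "2 \<le> n"
  shows "eval3 P a b (- b) = 0" "eval3 P b a (- b) = 0" "eval3 P b (- b) a = 0"
proof -
  define J :: "'p \<Rightarrow> 'p gvec \<Rightarrow> 'p gvec" where "J = diagonal_endomorphism (\<lambda>i. if i = 0 then a else b)"
  let ?T = "poly_action P J (courant_element M)" and ?v = "vector_section M 1" and ?w = "covector_section M 1"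
  define f where "f = (\<lambda>p. cmap c p 0)"
  have J: "bundle_endomorphism M J" and "skew M J"
    by (simp_all add: J_def bundle_endomorphism_copy skew_diagonal_endomorphism)
  have f: "f \<in> smooth_functions M"
    unfolding f_def by (rule coordinate_copy)
  define p where "p = e (\<lambda>i. 0)"
  have p: "p \<in> points M"
    by (simp add: points_copy p_def E_def topspace_Euclidean_space)
  have "smooth_trilinear M ?T"
    using P J \<open>skew M J\<close> smooth_manifold_copy unfolding tensorial_def tensorial_pair_def by blast
  then have T: "?T (sec_scale f x) y z p = f p * ?T x y z p" "?T x (sec_scale f y) z p = f p * ?T x y z p"
    if "x \<in> gsections M" "y \<in> gsections M" "z \<in> gsections M" for x y z
    using that f p unfolding smooth_trilinear_def by blast+
  note scale_1 = poly_action_scale_1[OF smooth_manifold_copy J p _ _ _ f, of _ _ _ P]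
  note scale_2 = poly_action_scale_2[OF smooth_manifold_copy J p _ _ _ f, of _ _ _ P]
  have pow: "(act J ^^ k) (?v 0) = vector_section M (a ^ k) 0" "(act J ^^ k) (?v 1) = vector_section M (b ^ k) 1"
    "(act J ^^ k) (?w 1) = covector_section M ((- b) ^ k) 1" for k
    unfolding J_def by (simp_all only: act_diagonal_vector_section act_diagonal_covector_section) simp_all
  have anchor: "anchor_derivative M (vector_section M r 0) f p = r"
    "anchor_derivative M (covector_section M r m) f p = 0" for r m
    using n p by (simp_all add: anchor_derivative_copy f_def cpartial_coordinate_copy)
  have inner: "ginner M p (vector_section M r 1 p) (covector_section M s 1 p) = r * s / 2"
    "ginner M p (covector_section M s 1 p) (vector_section M r 1 p) = r * s / 2" for r s
    using n p by (simp_all add: ginner_copy)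
  have "monomial_sum P (\<lambda>i j k. a ^ i * (b ^ j * (- b) ^ k / 2)) = 0"
    using scale_2[of "?v 0" "?v 1" "?w 1"] T(2)[of "?v 0" "?v 1" "?w 1"]
    unfolding pow anchor inner by (simp add: sections_copy)
  then have "monomial_sum P (\<lambda>i j k. (1 / 2) * (a ^ i * b ^ j * (- b) ^ k)) = 0"
    by (simp add: mult_ac)
  then show "eval3 P a b (- b) = 0"
    unfolding monomial_sum_scale monomial_sum_powers by simp
  \<comment> \<open>The defect with \<open>\<pi>(z) f\<close> is absent because the third argument is a covector field.\<close>
  have "monomial_sum P (\<lambda>i j k. a ^ j * (b ^ i * (- b) ^ k / 2)) = 0"
    using scale_1[of "?v 1" "?v 0" "?w 1"] T(1)[of "?v 1" "?v 0" "?w 1"]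
    unfolding pow anchor inner by (simp add: sections_copy monomial_sum_eq)
  then have "monomial_sum P (\<lambda>i j k. (1 / 2) * (b ^ i * a ^ j * (- b) ^ k)) = 0"
    by (simp add: mult_ac)
  then show "eval3 P b a (- b) = 0"
    unfolding monomial_sum_scale monomial_sum_powers by simp
  \<comment> \<open>Now the second argument is the covector field, and the defect with \<open>\<pi>(y) f\<close> is absent.\<close>
  have "monomial_sum P (\<lambda>i j k. a ^ k * (b ^ i * (- b) ^ j / 2)) = 0"
    using scale_1[of "?v 1" "?w 1" "?v 0"] T(1)[of "?v 1" "?w 1" "?v 0"]
    unfolding pow anchor inner by (simp add: sections_copy monomial_sum_eq)
  then have "monomial_sum P (\<lambda>i j k. (1 / 2) * (b ^ i * (- b) ^ j * a ^ k)) = 0"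
    by (simp add: mult_ac)
  then show "eval3 P b (- b) a = 0"
    unfolding monomial_sum_scale monomial_sum_powers by simp
qed

end

section \<open>The ideal of tensorial polynomials\<close>

text \<open>
  The plane has as many points as the line, so an injection of the reals yields a copy of the plane.
\<close>

lemma dvd_if_tensorial:
  assumes universe: "\<exists>e :: real \<Rightarrow> 'p. inj e" and P: "tensorial TYPE('p) P"
  shows "(var_y + var_z) * (var_z + var_x) * (var_x + var_y) dvd P"
proof -
  obtain r :: "real \<Rightarrow> 'p" where r: "inj r"
    using universe by blast
  have "\<exists>h :: real \<times> real \<Rightarrow> real. bij_betw h (UNIV \<times> UNIV) UNIV"
    unfolding card_of_ordIso by (rule card_of_Times_same_infinite[OF infinite_UNIV_char_0])
  then obtain h :: "real \<times> real \<Rightarrow> real" where h: "inj h"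
    unfolding bij_betw_def UNIV_Times_UNIV by (elim exE conjE)
  define e where "e u = r (h (u 0, u 1))" for u :: "nat \<Rightarrow> real"
  have "inj_on e (topspace (Euclidean_space 2))"
  proof
    fix u v assume uv: "u \<in> topspace (Euclidean_space 2)" "v \<in> topspace (Euclidean_space 2)" "e u = e v"
    then have 01: "u 0 = v 0" "u 1 = v 1"
      using injD[OF h injD[OF r uv(3)[unfolded e_def]]] by simp_all
    have "u i = v i" for i
    proof (cases "2 \<le> i")
      case True
      then show ?thesis
        using uv by (simp add: topspace_Euclidean_space)
    next
      case False
      then have "i = 0 \<or> i = 1"
        by arith
      then show ?thesis
        using 01 by auto
    qed
    then show "u = v"
      by (rule ext)
  qed
  note eval = tensorial_eval3_eq_0[OF this P order_refl]
  show ?thesis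
    using eval(3) eval(1) eval(2) by (rule dvd_product_of_linear_forms)
qed

theorem theorem14:
  assumes universe: "\<exists>e :: real \<Rightarrow> 'p. inj e"
  shows "{P. tensorial TYPE('p) P} =
    (ideal_x \<cdot>\<^bsub>poly3_ring\<^esub> ideal_y) \<cdot>\<^bsub>poly3_ring\<^esub> ideal_z"
  unfolding ideal_product_eq_multiples
proof (rule Collect_cong, rule iffI)
  fix P assume "tensorial TYPE('p) P"
  with universe show "(var_y + var_z) * (var_z + var_x) * (var_x + var_y) dvd P"
    by (rule dvd_if_tensorial)
next
  fix P assume "(var_y + var_z) * (var_z + var_x) * (var_x + var_y) dvd P"
  then show "tensorial TYPE('p) P"
    by (rule tensorial_if_dvd)
qed

end
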